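(* Let $n=2$ or $n=3$, let $p>1$, and let $F\in C^1(\mathbb{R})$ satisfy $F(s)\ge A s^p$ for all $s\ge 0$, for some constant $A>0$. Let $0<\kappa<\kappa_0:=\frac{2}{p-1}$. Let $f\in C^3(\mathbb{R}^n)$ and $g\in C^2(\mathbb{R}^n)$, and suppose there exist constants $R>0$ and $C_0>0$ such that for all $|x|\ge R$, $$f(x)>0 \quad\text{and}\quad \frac{f(x)}{1+|x|}-|\nabla f(x)|+g(x)\ge \frac{C_0}{(1+|x|)^{1+\kappa}}.$$ Let $u$ be a solution of the Cauchy problem $$u_{tt}-\Delta u=F(u)\ \text{ in } \mathbb{R}^n\times[0,\infty),\qquad u(x,0)=f(x),\ u_t(x,0)=g(x)\ \text{ in }\mathbb{R}^n.$$ Then $u$ cannot exist globally in time.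
   Context: Here $\Delta$ is the Laplacian in $x\in\mathbb{R}^n$ and $u=u(x,t)$ is a scalar (classical) solution; "cannot exist globally in time" means there is no solution defined for all $t\in[0,\infty)$. No radial symmetry is assumed. *)

theory Defs
  imports "HOL-Analysis.Analysis"
begin

definition pdx :: "'n::finite \<Rightarrow> (real^'n \<Rightarrow> real) \<Rightarrow> real^'n \<Rightarrow> real" where
  "pdx i f x = deriv (\<lambda>s. f (x + s *\<^sub>R axis i 1)) 0"

fun Ck_space :: "nat \<Rightarrow> (real^'n::finite \<Rightarrow> real) \<Rightarrow> bool" where
  "Ck_space 0 f = continuous_on UNIV f"
| "Ck_space (Suc k) f =
     (continuous_on UNIV f \<and>
      (\<forall>i x. (\<lambda>s. f (x + s *\<^sub>R axis i 1)) differentiable (at 0)) \<and>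
      (\<forall>i. Ck_space k (pdx i f)))"

definition grad :: "(real^'n::finite \<Rightarrow> real) \<Rightarrow> real^'n \<Rightarrow> real^'n" where
  "grad f x = (\<chi> i. pdx i f x)"

definition pdx_st :: "'n::finite \<Rightarrow> (real^'n \<Rightarrow> real \<Rightarrow> real) \<Rightarrow> real^'n \<Rightarrow> real \<Rightarrow> real" where
  "pdx_st i u x t = deriv (\<lambda>s. u (x + s *\<^sub>R axis i 1) t) 0"

definition pdt_st :: "(real^'n::finite \<Rightarrow> real \<Rightarrow> real) \<Rightarrow> real^'n \<Rightarrow> real \<Rightarrow> real" where
  "pdt_st u x t = vector_derivative (\<lambda>s. u x s) (at t within {0..})"

fun Ck_halfspace :: "nat \<Rightarrow> (real^'n::finite \<Rightarrow> real \<Rightarrow> real) \<Rightarrow> bool" where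
  "Ck_halfspace 0 u = continuous_on (UNIV \<times> {0..}) (\<lambda>(x, t). u x t)"
| "Ck_halfspace (Suc k) u =
     (continuous_on (UNIV \<times> {0..}) (\<lambda>(x, t). u x t) \<and>
      (\<forall>i x t. t \<ge> 0 \<longrightarrow> (\<lambda>s. u (x + s *\<^sub>R axis i 1) t) differentiable (at 0)) \<and>
      (\<forall>x t. t \<ge> 0 \<longrightarrow> (\<lambda>s. u x s) differentiable (at t within {0..})) \<and>
      (\<forall>i. Ck_halfspace k (pdx_st i u)) \<and>
      Ck_halfspace k (pdt_st u))"

definition global_classical_solution ::
  "(real \<Rightarrow> real) \<Rightarrow> (real^'n::finite \<Rightarrow> real) \<Rightarrow> (real^'n \<Rightarrow> real) \<Rightarrow> (real^'n \<Rightarrow> real \<Rightarrow> real) \<Rightarrow> bool" where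
  "global_classical_solution F f g u \<longleftrightarrow>
     Ck_halfspace 2 u \<and>
     (\<forall>x t. t \<ge> 0 \<longrightarrow>
        pdt_st (pdt_st u) x t - (\<Sum>i\<in>UNIV. pdx_st i (pdx_st i u) x t) = F (u x t)) \<and>
     (\<forall>x. u x 0 = f x) \<and>
     (\<forall>x. pdt_st u x 0 = g x)"

end

theory Submission
  imports Defs "HOL-Real_Asymp.Real_Asymp"
begin

text \<open>
  Fix a point at distance \<open>2 * T\<close> from the origin and the backward cone over the ball of radius \<open>T\<close>
  around it. In two and three dimensions Kirchhoff's formula has a positive kernel, and in the cone the
  data condition makes the free solution at least \<open>M * t\<close> with \<open>M = C\<^sub>0 / (1 + 3 * T) powr (1 + \<kappa>)\<close>.
  A first-time argument shows that the solution stays positive in the cone, so the nonlinearity is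
  nonnegative there and \<open>u \<ge> M * t\<close>. A second first-time argument, started at time \<open>T / 2\<close>, compares
  \<open>u\<close> with the spatially constant solution \<open>B * (T - t) powr (- 2 / (p - 1))\<close> of \<open>v'' = A * v powr p\<close>,
  which starts below \<open>M * t\<close> once \<open>T\<close> is large. Hence \<open>u\<close> is unbounded on the axis of the cone as \<open>t\<close>
  tends to \<open>T\<close>, contradicting continuity.
\<close>

section \<open>Differentiability from continuous partial derivatives\<close>

text \<open>The mean value theorem for an increment of either sign, as needed for coordinate
  increments \<open>h \<bullet> b\<close>.\<close>

lemma mvt_signed:
  fixes g g' :: "real \<Rightarrow> real"
  assumes "\<And>s. \<bar>s\<bar> \<le> \<bar>c\<bar> \<Longrightarrow> (g has_real_derivative g' s) (at s)"
  shows "\<exists>\<xi>. \<bar>\<xi>\<bar> \<le> \<bar>c\<bar> \<and> g c - g 0 = c * g' \<xi>"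
proof (cases c "0::real" rule: linorder_cases)
  case less
  obtain z where "c < z" "z < 0" "g 0 - g c = (0 - c) * g' z"
    using MVT2[of c 0 g g'] assms less by force
  then show ?thesis by (intro exI[of _ z]) (auto simp: algebra_simps)
next
  case equal
  then show ?thesis by auto
next
  case greater
  obtain z where "0 < z" "z < c" "g c - g 0 = (c - 0) * g' z"
    using MVT2[of 0 c g g'] assms greater by force
  then show ?thesis by (intro exI[of _ z]) auto
qed

text \<open>Move from \<open>x\<close> to \<open>x + h\<close> one coordinate at a time: the mean
  value theorem turns each move into a partial derivative at a nearby point, and continuity at
  \<open>x\<close> replaces it by the value at \<open>x\<close> with error small against
  \<open>norm h\<close>.\<close>

lemma has_derivative_continuous_partials:
  fixes f :: "'a::euclidean_space \<Rightarrow> real"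
  assumes S: "open S" "x \<in> S"
    and der: "\<And>y b. y \<in> S \<Longrightarrow> b \<in> Basis \<Longrightarrow> ((\<lambda>s. f (y + s *\<^sub>R b)) has_real_derivative D b y) (at 0)"
    and cont: "\<And>b. b \<in> Basis \<Longrightarrow> isCont (D b) x"
  shows "(f has_derivative (\<lambda>h. \<Sum>b\<in>Basis. (h \<bullet> b) * D b x)) (at x)"
proof -
  define pr where "pr B h = (\<Sum>b\<in>B. (h \<bullet> b) *\<^sub>R b)" for B and h :: 'a
  have pr_norm: "norm (pr B h) \<le> DIM('a) * norm h" if "B \<subseteq> Basis" for B h
  proof -
    have "norm (pr B h) \<le> (\<Sum>b\<in>B. norm h)"
      unfolding pr_def using that by (intro sum_norm_le) (auto simp: Basis_le_norm)
    also have "\<dots> \<le> DIM('a) * norm h"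
      using card_mono[OF finite_Basis that] by (simp add: mult_right_mono)
    finally show ?thesis .
  qed
  have der': "((\<lambda>s. f (y + s *\<^sub>R b)) has_real_derivative D b (y + s *\<^sub>R b)) (at s)"
    if "y + s *\<^sub>R b \<in> S" "b \<in> Basis" for y b s
    using der[OF that] DERIV_shift[of "\<lambda>s. f (y + s *\<^sub>R b)" "D b (y + s *\<^sub>R b)" 0 s]
    by (simp add: algebra_simps)
  \<comment> \<open>Induction on the set \<open>B\<close> of coordinates already moved;
    \<open>pr B h\<close> is the displacement reached so far.\<close>
  have key: "\<forall>e>0. \<exists>d>0. \<forall>h. norm h < d \<longrightarrow>
      \<bar>f (x + pr B h) - f x - (\<Sum>b\<in>B. (h \<bullet> b) * D b x)\<bar> \<le> e * norm h"
    if "finite B" "B \<subseteq> Basis" for B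
    using that
  proof (induction B rule: finite_induct)
    case empty
    then show ?case by (auto simp: pr_def intro!: exI[of _ 1])
  next
    case (insert b B)
    show ?case
    proof (intro allI impI)
      fix e :: real assume "e > 0"
      then have e2: "e / 2 > 0" by simp
      from insert obtain d1 where d1: "d1 > 0" "\<And>h. norm h < d1 \<Longrightarrow>
          \<bar>f (x + pr B h) - f x - (\<Sum>b\<in>B. (h \<bullet> b) * D b x)\<bar> \<le> e / 2 * norm h"
        using e2 by (metis insert_subset)
      from S obtain d2 where d2: "d2 > 0" "ball x d2 \<subseteq> S"
        by (meson openE)
      from insert cont[of b] e2 obtain d3 where d3: "d3 > 0" "\<And>y. dist y x < d3 \<Longrightarrow> \<bar>D b y - D b x\<bar> < e / 2"
        unfolding continuous_at_eps_delta dist_real_def by (metis insert_subset)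
      \<comment> \<open>The displacement along \<open>B\<close> is at most
        \<open>DIM('a) * norm h\<close> and the next coordinate adds at most \<open>norm h\<close>,
        so dividing by \<open>DIM('a) + 1\<close> keeps all intermediate points within
        \<open>min d2 d3\<close> of \<open>x\<close>.\<close>
      define d where "d = min d1 (min d2 d3 / (DIM('a) + 1))"
      have "d > 0" using d1 d2 d3 by (auto simp: d_def)
      moreover have "\<bar>f (x + pr (insert b B) h) - f x - (\<Sum>b\<in>insert b B. (h \<bullet> b) * D b x)\<bar> \<le> e * norm h"
        if h: "norm h < d" for h
      proof -
        have near: "dist (x + pr B h + s *\<^sub>R b) x < min d2 d3" if "\<bar>s\<bar> \<le> \<bar>h \<bullet> b\<bar>" for s
        proof -
          have "dist (x + pr B h + s *\<^sub>R b) x \<le> norm (pr B h) + norm (s *\<^sub>R b)"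
            using norm_triangle_ineq[of "pr B h" "s *\<^sub>R b"] by (simp add: dist_norm add.assoc del: norm_scaleR)
          also have "norm (s *\<^sub>R b) \<le> norm h"
            using that insert.prems Basis_le_norm[of b h] by auto
          also have "norm (pr B h) \<le> DIM('a) * norm h"
            using pr_norm insert.prems by auto
          also have "DIM('a) * norm h + norm h = (DIM('a) + 1) * norm h"
            by (simp add: algebra_simps)
          also have "\<dots> < min d2 d3"
          proof -
            have "norm h < min d2 d3 / (DIM('a) + 1)" using h by (simp add: d_def)
            then show ?thesis by (simp add: pos_less_divide_eq mult.commute)
          qed
          finally show ?thesis by simp
        qed
        have b: "b \<in> Basis" using insert by auto
        have "((\<lambda>s. f ((x + pr B h) + s *\<^sub>R b)) has_real_derivative D b (x + pr B h + s *\<^sub>R b)) (at s)"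
          if "\<bar>s\<bar> \<le> \<bar>h \<bullet> b\<bar>" for s
          using near[OF that] d2 b by (intro der') (auto simp: dist_commute)
        from mvt_signed[OF this] obtain \<xi> where xi: "\<bar>\<xi>\<bar> \<le> \<bar>h \<bullet> b\<bar>"
          "f (x + pr B h + (h \<bullet> b) *\<^sub>R b) - f (x + pr B h) = (h \<bullet> b) * D b (x + pr B h + \<xi> *\<^sub>R b)"
          by auto
        have D: "\<bar>D b (x + pr B h + \<xi> *\<^sub>R b) - D b x\<bar> \<le> e / 2"
          using d3(2) near[OF xi(1)] by (simp add: less_imp_le)
        have "\<bar>(h \<bullet> b) * (D b (x + pr B h + \<xi> *\<^sub>R b) - D b x)\<bar> \<le> norm h * (e / 2)"
          unfolding abs_mult using D b by (intro mult_mono) (auto simp: Basis_le_norm)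
        moreover have "\<bar>f (x + pr B h) - f x - (\<Sum>b\<in>B. (h \<bullet> b) * D b x)\<bar> \<le> norm h * (e / 2)"
          using d1 h by (simp add: d_def mult.commute)
        moreover have "f (x + pr (insert b B) h) - f x - (\<Sum>b\<in>insert b B. (h \<bullet> b) * D b x) =
          (h \<bullet> b) * (D b (x + pr B h + \<xi> *\<^sub>R b) - D b x) + (f (x + pr B h) - f x - (\<Sum>b\<in>B. (h \<bullet> b) * D b x))"
        proof -
          have "x + pr (insert b B) h = x + pr B h + (h \<bullet> b) *\<^sub>R b"
            using insert by (simp add: pr_def)
          then show ?thesis using insert xi(2) by (simp add: algebra_simps)
        qed
        moreover have "norm h * (e / 2) + norm h * (e / 2) = e * norm h" by simp
        ultimately show ?thesis by linarith
      qed
      ultimately show "\<exists>d>0. \<forall>h. norm h < d \<longrightarrow>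
          \<bar>f (x + pr (insert b B) h) - f x - (\<Sum>b\<in>insert b B. (h \<bullet> b) * D b x)\<bar> \<le> e * norm h"
        by blast
    qed
  qed
  have pr_Basis: "pr Basis h = h" for h
    by (simp add: pr_def euclidean_representation)
  show ?thesis
    unfolding has_derivative_at_alt
  proof safe
    show "bounded_linear (\<lambda>h. \<Sum>b\<in>Basis. (h \<bullet> b) * D b x)"
      by (intro bounded_linear_intros bounded_linear_sum) 
    fix e :: real assume "e > 0"
    then obtain d where d: "d > 0" "\<And>h. norm h < d \<Longrightarrow>
      \<bar>f (x + h) - f x - (\<Sum>b\<in>Basis. (h \<bullet> b) * D b x)\<bar> \<le> e * norm h"
      using key[of Basis] by (auto simp: pr_Basis)
    show "\<exists>d>0. \<forall>y. norm (y - x) < d \<longrightarrow>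
        norm (f y - f x - (\<Sum>b\<in>Basis. ((y - x) \<bullet> b) * D b x)) \<le> e * norm (y - x)"
      using d(1) d(2)[of "_ - x"] by auto
  qed
qed

text \<open>\<open>Ck_halfspace\<close> speaks only of continuous partial derivatives along the
  axes, with the time derivative taken within the half-line. At positive times these are continuous
  partials on an open set, so \<open>w\<close> is Frechet differentiable there and the usual chain
  rule applies.\<close>

lemma Ck_halfspace_chain:
  fixes w :: "real^'n::finite \<Rightarrow> real \<Rightarrow> real"
  assumes w: "Ck_halfspace 1 w"
    and c: "(c has_vector_derivative c') (at s)" and \<tau>: "(\<tau> has_real_derivative \<tau>') (at s)"
    and pos: "\<tau> s > 0"
  shows "((\<lambda>s. w (c s) (\<tau> s)) has_real_derivative
    (\<Sum>i\<in>UNIV. c' $ i * pdx_st i w (c s) (\<tau> s)) + \<tau>' * pdt_st w (c s) (\<tau> s)) (at s)"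
proof -
  define S :: "((real^'n) \<times> real) set" where "S = UNIV \<times> {0<..}"
  \<comment> \<open>A basis vector of the product is \<open>(axis i 1, 0)\<close> or
    \<open>(0, 1)\<close>; the second component tells the two kinds apart, and the sum picks out the
    \<open>i\<close>-th partial derivative.\<close>
  define D where "D b z = (if snd b = 0 then (\<Sum>i\<in>UNIV. fst b $ i * pdx_st i w (fst z) (snd z))
       else pdt_st w (fst z) (snd z))" for b z :: "(real^'n) \<times> real"
  define f where "f z = w (fst z) (snd z)" for z :: "(real^'n) \<times> real"
  have S: "open S" unfolding S_def by (intro open_Times) auto
  have Sub: "S \<subseteq> UNIV \<times> {0..}" by (auto simp: S_def)
  have contx: "continuous_on S (\<lambda>z. pdx_st i w (fst z) (snd z))" for i
    using w Sub by (auto simp: case_prod_unfold intro: continuous_on_subset)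
  have contt: "continuous_on S (\<lambda>z. pdt_st w (fst z) (snd z))"
    using w Sub by (auto simp: case_prod_unfold intro: continuous_on_subset)
  have contD: "continuous_on S (D b)" for b
    by (cases "snd b = 0") (auto simp: D_def[abs_def] intro!: contt continuous_intros contx)
  have axis: "(\<Sum>j\<in>UNIV. axis i (1::real) $ j * g j) = g i" for i :: 'n and g
    by (simp add: axis_def if_distrib[of "\<lambda>x. x * _"] sum.delta cong: if_cong)
  have der: "((\<lambda>s. f (y + s *\<^sub>R b)) has_real_derivative D b y) (at 0)" if "y \<in> S" "b \<in> Basis" for y b
  proof -
    obtain x t where y: "y = (x, t)" "t > 0" using \<open>y \<in> S\<close> by (auto simp: S_def)
    from \<open>b \<in> Basis\<close> consider i where "b = (axis i 1, 0)" | "b = (0, 1)"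
      by (auto simp: Basis_prod_def Basis_vec_def)
    then show ?thesis
    proof cases
      case 1
      have "(\<lambda>s. w (x + s *\<^sub>R axis i 1) t) differentiable (at 0)"
        using w y by auto
      then have "((\<lambda>s. w (x + s *\<^sub>R axis i 1) t) has_real_derivative pdx_st i w x t) (at 0)"
        unfolding pdx_st_def using DERIV_deriv_iff_real_differentiable by blast
      with 1 y show ?thesis by (simp add: f_def D_def axis)
    next
      case 2
      have "(\<lambda>s. w x s) differentiable (at t within {0..})"
        using w y by auto
      \<comment> \<open>A positive time is interior to the half-line, so the derivative within
        \<open>{0..}\<close> is two-sided.\<close>
      moreover have at: "at t within {0..} = at t"
        using y by (intro at_within_interior) (auto simp: interior_Ici[of "0 - 1"])
      ultimately have "((\<lambda>s. w x s) has_real_derivative pdt_st w x t) (at t)"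
        unfolding pdt_st_def at has_real_derivative_iff_has_vector_derivative
        using vector_derivative_works by blast
      then have "((\<lambda>s. w x (s + t)) has_real_derivative pdt_st w x t) (at 0)"
        using DERIV_shift[of "w x" "pdt_st w x t" 0 t] by simp
      with 2 y show ?thesis by (simp add: f_def D_def add.commute)
    qed
  qed
  let ?z = "(c s, \<tau> s)"
  have z: "?z \<in> S" using pos by (simp add: S_def)
  have "(f has_derivative (\<lambda>h. \<Sum>b\<in>Basis. (h \<bullet> b) * D b ?z)) (at ?z)"
    by (rule has_derivative_continuous_partials[OF S z der])
       (use contD S z in \<open>auto simp: continuous_on_eq_continuous_at\<close>)
  moreover have "((\<lambda>s. (c s, \<tau> s)) has_derivative (\<lambda>h. (h *\<^sub>R c', h *\<^sub>R \<tau>'))) (at s)"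
    using c \<tau> unfolding has_vector_derivative_def has_real_derivative_iff_has_vector_derivative
    by (intro has_derivative_Pair)
  ultimately have "(f \<circ> (\<lambda>s. (c s, \<tau> s)) has_derivative
      (\<lambda>h. \<Sum>b\<in>Basis. (h *\<^sub>R c', h *\<^sub>R \<tau>') \<bullet> b * D b ?z)) (at s)"
    using diff_chain_at by (fastforce simp: o_def)
  moreover have "(\<Sum>b\<in>Basis. (h *\<^sub>R c', h *\<^sub>R \<tau>') \<bullet> b * D b ?z) =
     ((\<Sum>i\<in>UNIV. c' $ i * pdx_st i w (c s) (\<tau> s)) + \<tau>' * pdt_st w (c s) (\<tau> s)) * h" for h
  proof -
    have Basis: "(Basis :: ((real^'n) \<times> real) set) = range (\<lambda>i. (axis i 1, 0)) \<union> {(0, 1)}"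
      by (auto simp: Basis_prod_def Basis_vec_def)
    have inj: "inj (\<lambda>i::'n. (axis i (1::real), 0::real))"
      by (auto simp: inj_def axis_eq_axis)
    show ?thesis
      unfolding Basis
      by (subst sum.union_disjoint)
         (auto simp: sum.reindex[OF inj] o_def D_def axis inner_axis algebra_simps sum_distrib_left)
  qed
  ultimately show ?thesis
    by (simp add: has_field_derivative_def o_def f_def mult_commute_abs)
qed

section \<open>Symmetry of mixed partial derivatives\<close>

text \<open>Apply the mean value theorem in the first variable to \<open>f s (b+h) - f s b\<close>,
  then in the second variable to \<open>f1 \<xi>\<close>.\<close>

lemma mixed_difference_quotient:
  fixes f f1 f12 :: "real \<Rightarrow> real \<Rightarrow> real"
  assumes h: "h > 0"
    and d1: "\<And>s \<tau>. s \<in> {a..a+h} \<Longrightarrow> \<tau> \<in> {b..b+h} \<Longrightarrow> ((\<lambda>s. f s \<tau>) has_real_derivative f1 s \<tau>) (at s)"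
    and d12: "\<And>s \<tau>. s \<in> {a..a+h} \<Longrightarrow> \<tau> \<in> {b..b+h} \<Longrightarrow> (f1 s has_real_derivative f12 s \<tau>) (at \<tau>)"
  shows "\<exists>\<xi>\<in>{a..a+h}. \<exists>\<eta>\<in>{b..b+h}. f (a+h) (b+h) - f (a+h) b - f a (b+h) + f a b = h * h * f12 \<xi> \<eta>"
proof -
  have "((\<lambda>s. f s (b+h) - f s b) has_real_derivative f1 s (b+h) - f1 s b) (at s)" if "s \<in> {a..a+h}" for s
    using that h by (intro derivative_intros d1) auto
  with h obtain \<xi> where \<xi>: "a < \<xi>" "\<xi> < a + h"
    "(f (a+h) (b+h) - f (a+h) b) - (f a (b+h) - f a b) = (a + h - a) * (f1 \<xi> (b+h) - f1 \<xi> b)"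
    using MVT2[of a "a+h" "\<lambda>s. f s (b+h) - f s b" "\<lambda>s. f1 s (b+h) - f1 s b"] by auto
  moreover obtain \<eta> where \<eta>: "b < \<eta>" "\<eta> < b + h" "f1 \<xi> (b+h) - f1 \<xi> b = (b + h - b) * f12 \<xi> \<eta>"
    using MVT2[of b "b+h" "f1 \<xi>" "f12 \<xi>"] h d12 \<xi> by auto
  ultimately show ?thesis by (intro bexI[of _ \<xi>] bexI[of _ \<eta>]) auto
qed

text \<open>The second difference over a small square is symmetric in the two variables, so it
  equals \<open>h * h\<close> times a value of \<open>f12\<close> and also \<open>h * h\<close>
  times a value of \<open>f21\<close> in that square. Continuity at the corner forces the two limits
  to agree.\<close>

lemma mixed_partials_commute:
  fixes f f1 f2 f12 f21 :: "real \<Rightarrow> real \<Rightarrow> real"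
  assumes r: "r > 0"
    and d1: "\<And>s \<tau>. s \<in> {a..a+r} \<Longrightarrow> \<tau> \<in> {b..b+r} \<Longrightarrow> ((\<lambda>s. f s \<tau>) has_real_derivative f1 s \<tau>) (at s)"
    and d2: "\<And>s \<tau>. s \<in> {a..a+r} \<Longrightarrow> \<tau> \<in> {b..b+r} \<Longrightarrow> (f s has_real_derivative f2 s \<tau>) (at \<tau>)"
    and d12: "\<And>s \<tau>. s \<in> {a..a+r} \<Longrightarrow> \<tau> \<in> {b..b+r} \<Longrightarrow> (f1 s has_real_derivative f12 s \<tau>) (at \<tau>)"
    and d21: "\<And>s \<tau>. s \<in> {a..a+r} \<Longrightarrow> \<tau> \<in> {b..b+r} \<Longrightarrow> ((\<lambda>s. f2 s \<tau>) has_real_derivative f21 s \<tau>) (at s)"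
    and cont: "isCont (\<lambda>z. f12 (fst z) (snd z)) (a, b)" "isCont (\<lambda>z. f21 (fst z) (snd z)) (a, b)"
  shows "f12 a b = f21 a b"
proof (rule ccontr)
  assume ne: "f12 a b \<noteq> f21 a b"
  define e where "e = \<bar>f12 a b - f21 a b\<bar> / 2"
  have e: "e > 0" using ne by (simp add: e_def)
  obtain d where d: "d > 0" "\<And>z. dist z (a, b) < d \<Longrightarrow> \<bar>f12 (fst z) (snd z) - f12 a b\<bar> < e"
    using cont(1) e unfolding continuous_at_eps_delta dist_real_def by fastforce
  obtain d' where d': "d' > 0" "\<And>z. dist z (a, b) < d' \<Longrightarrow> \<bar>f21 (fst z) (snd z) - f21 a b\<bar> < e"
    using cont(2) e unfolding continuous_at_eps_delta dist_real_def by fastforce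
  define h where "h = min r (min d d' / 4)"
  have h: "h > 0" "h \<le> r" "2 * h < d" "2 * h < d'" using d d' r by (auto simp: h_def min_def field_simps)
  have near: "dist (\<xi>, \<eta>) (a, b) \<le> 2 * h" if "\<xi> \<in> {a..a+h}" "\<eta> \<in> {b..b+h}" for \<xi> \<eta>
  proof -
    have "dist (\<xi>, \<eta>) (a, b) \<le> \<bar>\<xi> - a\<bar> + \<bar>\<eta> - b\<bar>"
      by (simp add: dist_Pair_Pair dist_real_def sqrt_sum_squares_le_sum_abs[of "\<bar>\<xi> - a\<bar>" "\<bar>\<eta> - b\<bar>", simplified])
    then show ?thesis using that by auto
  qed
  obtain \<xi> \<eta> where 1: "\<xi> \<in> {a..a+h}" "\<eta> \<in> {b..b+h}"
      "f (a+h) (b+h) - f (a+h) b - f a (b+h) + f a b = h * h * f12 \<xi> \<eta>"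
    using mixed_difference_quotient[of h a b f f1 f12] h d1 d12 by force
  obtain \<eta>' \<xi>' where 2: "\<xi>' \<in> {a..a+h}" "\<eta>' \<in> {b..b+h}"
      "f (a+h) (b+h) - f a (b+h) - f (a+h) b + f a b = h * h * f21 \<xi>' \<eta>'"
    \<comment> \<open>The same second difference with the roles of the variables exchanged.\<close>
    using mixed_difference_quotient[of h b a "\<lambda>\<tau> s. f s \<tau>" "\<lambda>\<tau> s. f2 s \<tau>" "\<lambda>\<tau> s. f21 s \<tau>"] h d2 d21 by force
  have "h * h * f12 \<xi> \<eta> = h * h * f21 \<xi>' \<eta>'" using 1 2 by linarith
  then have "f12 \<xi> \<eta> = f21 \<xi>' \<eta>'" using h by simp
  moreover have "\<bar>f12 \<xi> \<eta> - f12 a b\<bar> < e" using d(2)[of "(\<xi>, \<eta>)"] near[OF 1(1,2)] h by simp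
  moreover have "\<bar>f21 \<xi>' \<eta>' - f21 a b\<bar> < e" using d'(2)[of "(\<xi>', \<eta>')"] near[OF 2(1,2)] h by simp
  ultimately show False unfolding e_def by (simp add: abs_if split: if_splits)
qed

lemma Ck_halfspace_2D:
  assumes "Ck_halfspace 2 u"
  shows "Ck_halfspace 1 u" "Ck_halfspace 1 (pdx_st i u)" "Ck_halfspace 1 (pdt_st u)"
  using assms by (auto simp: numeral_2_eq_2)

lemma Ck_halfspace_pdx:
  fixes w :: "real^'n::finite \<Rightarrow> real \<Rightarrow> real"
  assumes "Ck_halfspace 1 w" "t > 0"
  shows "((\<lambda>s. w (x + s *\<^sub>R axis i 1) t) has_real_derivative pdx_st i w (x + s *\<^sub>R axis i 1) t) (at s)"
proof -
  have "((\<lambda>s. x + s *\<^sub>R axis i 1) has_vector_derivative axis i 1) (at s)"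
    by (auto intro!: derivative_eq_intros)
  moreover have "((\<lambda>s. t) has_real_derivative 0) (at s)" by simp
  moreover have "(\<Sum>j\<in>UNIV. axis i (1::real) $ j * g j) = g i" for g :: "'n \<Rightarrow> real"
    by (simp add: axis_def if_distrib[of "\<lambda>x. x * _"] sum.delta cong: if_cong)
  ultimately show ?thesis
    using Ck_halfspace_chain[OF assms(1), of "\<lambda>s. x + s *\<^sub>R axis i 1" "axis i 1" s "\<lambda>s. t" 0] assms(2) by simp
qed

lemma Ck_halfspace_pdt:
  fixes w :: "real^'n::finite \<Rightarrow> real \<Rightarrow> real"
  assumes "Ck_halfspace 1 w" "t > 0"
  shows "(w x has_real_derivative pdt_st w x t) (at t)"
  using Ck_halfspace_chain[OF assms(1), of "\<lambda>s. x" 0 t "\<lambda>s. s" 1] assms(2) by simp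

lemma Ck_halfspace_continuous:
  assumes "Ck_halfspace 1 w"
  shows "continuous_on (UNIV \<times> {0..}) (\<lambda>z. w (fst z) (snd z))"
    "continuous_on (UNIV \<times> {0..}) (\<lambda>z. pdx_st i w (fst z) (snd z))"
    "continuous_on (UNIV \<times> {0..}) (\<lambda>z. pdt_st w (fst z) (snd z))"
  using assms by (auto simp: case_prod_unfold)

text \<open>Differentiating the Kirchhoff integrand produces the mixed derivative in both orders;
  this identity lets them cancel.\<close>

lemma pdt_pdx_commute:
  fixes u :: "real^'n::finite \<Rightarrow> real \<Rightarrow> real"
  assumes u: "Ck_halfspace 2 u" and t: "t > 0"
  shows "pdt_st (pdx_st i u) x t = pdx_st i (pdt_st u) x t"
proof -
  let ?e = "axis i 1 :: real^'n"
  note C = Ck_halfspace_2D[OF u]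
  have *: "isCont (\<lambda>z. g (x + fst z *\<^sub>R ?e) (snd z)) (0, t)"
    if g: "continuous_on (UNIV \<times> {0..}) (\<lambda>z. g (fst z) (snd z))" for g
  proof -
    have "continuous_on (UNIV \<times> {0<..}) (\<lambda>z. g (x + fst z *\<^sub>R ?e) (snd z))"
      by (rule continuous_on_compose2[OF g, of _ "\<lambda>z. (x + fst z *\<^sub>R ?e, snd z)", simplified])
         (auto intro!: continuous_intros)
    then show ?thesis
      using t by (subst (asm) continuous_on_eq_continuous_at) (auto intro!: open_Times)
  qed
  \<comment> \<open>The square has its corner at time \<open>t\<close> and extends to later times
    only, so side 1 keeps it in the region of positive times.\<close>
  have "pdt_st (pdx_st i u) (x + 0 *\<^sub>R ?e) t = pdx_st i (pdt_st u) (x + 0 *\<^sub>R ?e) t"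
    by (rule mixed_partials_commute[where r = 1 and a = 0 and b = t
          and f = "\<lambda>s \<tau>. u (x + s *\<^sub>R ?e) \<tau>" and ?f1.0 = "\<lambda>s \<tau>. pdx_st i u (x + s *\<^sub>R ?e) \<tau>"
          and ?f2.0 = "\<lambda>s \<tau>. pdt_st u (x + s *\<^sub>R ?e) \<tau>"])
       (use t in \<open>auto intro!: Ck_halfspace_pdx Ck_halfspace_pdt C
           *[OF Ck_halfspace_continuous(2)] *[OF Ck_halfspace_continuous(3)]\<close>)
  then show ?thesis by simp
qed

section \<open>Spherical coordinates and the divergence identity\<close>

definition sph :: "nat \<Rightarrow> real \<Rightarrow> real \<Rightarrow> real" where
  "sph k \<theta> \<phi> = (if k = 0 then sin \<theta> * cos \<phi> else if k = 1 then sin \<theta> * sin \<phi> else cos \<theta>)"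

definition sph_polar :: "nat \<Rightarrow> real \<Rightarrow> real \<Rightarrow> real" where
  "sph_polar k \<theta> \<phi> = (if k = 0 then cos \<theta> * cos \<phi> else if k = 1 then cos \<theta> * sin \<phi> else - sin \<theta>)"

text \<open>The \<open>\<phi>\<close>-derivative of the sphere point divided by
  \<open>sin \<theta>\<close>, hence a unit vector even at the poles.\<close>

definition sph_azim :: "nat \<Rightarrow> real \<Rightarrow> real" where
  "sph_azim k \<phi> = (if k = 0 then - sin \<phi> else if k = 1 then cos \<phi> else 0)"

text \<open>Keeping only the coordinates selected by an injection \<open>\<iota>\<close> into \<open>{0, 1, 2}\<close> projects the unit
  sphere of three-space to \<open>real^'n\<close>; for two variables this is Hadamard's method of descent.\<close>

definition sph_vec :: "('n \<Rightarrow> nat) \<Rightarrow> real \<Rightarrow> real \<Rightarrow> real^'n::finite" where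
  "sph_vec \<iota> \<theta> \<phi> = (\<chi> i. sph (\<iota> i) \<theta> \<phi>)"

lemma sph_deriv_polar: "((\<lambda>\<theta>. sph k \<theta> \<phi>) has_real_derivative sph_polar k \<theta> \<phi>) (at \<theta>)"
  unfolding sph_def sph_polar_def by (auto intro!: derivative_eq_intros)

lemma sph_polar_deriv: "((\<lambda>\<theta>. sph_polar k \<theta> \<phi>) has_real_derivative - sph k \<theta> \<phi>) (at \<theta>)"
  unfolding sph_def sph_polar_def by (auto intro!: derivative_eq_intros)

lemma sph_deriv_azim: "((\<lambda>\<phi>. sph k \<theta> \<phi>) has_real_derivative sin \<theta> * sph_azim k \<phi>) (at \<phi>)"
  unfolding sph_def sph_azim_def by (auto intro!: derivative_eq_intros)

lemma sin_mult_add_cos_mult: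
  "sin x * y * (sin x * z) + cos x * y * (cos x * z) = y * (z :: real)"
proof -
  have "sin x * y * (sin x * z) + cos x * y * (cos x * z) = ((sin x)\<^sup>2 + (cos x)\<^sup>2) * (y * z)"
    unfolding power2_eq_square by (simp add: distrib_left distrib_right mult.assoc mult.left_commute)
  then show ?thesis by simp
qed

text \<open>The derivative points horizontally towards the polar axis. It is written in the moving
  frame, although its value is independent of \<open>\<theta>\<close>, so that its polar part
  cancels a term of the \<open>\<theta>\<close>-derivative in the divergence identity.\<close>

lemma sph_azim_deriv:
  "(sph_azim k has_real_derivative - (sin \<theta> * sph k \<theta> \<phi> + cos \<theta> * sph_polar k \<theta> \<phi>)) (at \<phi>)"
proof -
  have *: "sin \<theta> * sph k \<theta> \<phi> + cos \<theta> * sph_polar k \<theta> \<phi> =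
    (if k = 0 then cos \<phi> else if k = 1 then sin \<phi> else 0)"
    using sin_mult_add_cos_mult[of \<theta> 1] by (auto simp: sph_def sph_polar_def)
  have "sph_azim k = (if k = 0 then (\<lambda>\<phi>. - sin \<phi>) else if k = 1 then cos else (\<lambda>\<phi>. 0))"
    by (auto simp: sph_azim_def)
  then show ?thesis
    unfolding * by (auto intro!: derivative_eq_intros)
qed

text \<open>Position, polar and azimuthal vectors form an orthonormal basis of three-space; this is
  the completeness relation, used to expand the diagonal entries of the Hessian.\<close>

lemma sph_orthonormal:
  assumes "k < 3" "l < 3"
  shows "sph k \<theta> \<phi> * sph l \<theta> \<phi> + sph_polar k \<theta> \<phi> * sph_polar l \<theta> \<phi> + sph_azim k \<phi> * sph_azim l \<phi>
    = (if k = l then 1 else 0)"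
proof -
  have "k = 0 \<or> k = 1 \<or> k = 2" "l = 0 \<or> l = 1 \<or> l = 2" using assms by auto
  moreover have "cos x * cos x + sin x * sin x = 1" "sin x * sin x + cos x * cos x = 1" for x :: real
    using sin_mult_add_cos_mult[of x 1 1] by simp_all
  ultimately show ?thesis
    by (elim disjE) (simp_all add: sph_def sph_polar_def sph_azim_def sin_mult_add_cos_mult)
qed

lemma sum_sph_squares: "(\<Sum>k<3. (sph k \<theta> \<phi>)\<^sup>2) = 1"
proof -
  have "(\<Sum>k<3. (sph k \<theta> \<phi>)\<^sup>2) =
    sin \<phi> * sin \<theta> * (sin \<phi> * sin \<theta>) + cos \<phi> * sin \<theta> * (cos \<phi> * sin \<theta>) + cos \<theta> * cos \<theta>"
    by (simp add: sph_def eval_nat_numeral mult_ac)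
  also have "\<dots> = 1"
    using sin_mult_add_cos_mult[of \<phi> "sin \<theta>" "sin \<theta>"] sin_mult_add_cos_mult[of \<theta> 1 1] by linarith
  finally show ?thesis .
qed

lemma continuous_sph [continuous_intros]:
  fixes f g :: "'a::t2_space \<Rightarrow> real"
  assumes "continuous_on S f" "continuous_on S g"
  shows "continuous_on S (\<lambda>x. sph k (f x) (g x))"
proof -
  consider "k = 0" | "k = 1" | "k \<noteq> 0" "k \<noteq> 1" by blast
  then show ?thesis
    by cases (auto simp: sph_def intro!: continuous_intros assms)
qed

lemma continuous_sph_polar [continuous_intros]:
  fixes f g :: "'a::t2_space \<Rightarrow> real"
  assumes "continuous_on S f" "continuous_on S g"
  shows "continuous_on S (\<lambda>x. sph_polar k (f x) (g x))"
proof -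
  consider "k = 0" | "k = 1" | "k \<noteq> 0" "k \<noteq> 1" by blast
  then show ?thesis
    by cases (auto simp: sph_polar_def intro!: continuous_intros assms)
qed

lemma continuous_sph_azim [continuous_intros]:
  fixes f :: "'a::t2_space \<Rightarrow> real"
  assumes "continuous_on S f"
  shows "continuous_on S (\<lambda>x. sph_azim k (f x))"
proof -
  consider "k = 0" | "k = 1" | "k \<noteq> 0" "k \<noteq> 1" by blast
  then show ?thesis
    by cases (auto simp: sph_azim_def intro!: continuous_intros assms)
qed

lemma continuous_sph_vec [continuous_intros]:
  fixes f g :: "'a::t2_space \<Rightarrow> real"
  assumes "continuous_on S f" "continuous_on S g"
  shows "continuous_on S (\<lambda>x. sph_vec \<iota> (f x) (g x))"
  unfolding sph_vec_def using assms by (intro continuous_intros)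

text \<open>The selected coordinates are some of those of a unit vector. With two of them, the
  points lie in the closed unit disc rather than on its boundary only.\<close>

lemma norm_sph_vec_le:
  assumes "inj \<iota>" "range \<iota> \<subseteq> {..<3}"
  shows "norm (sph_vec \<iota> \<theta> \<phi>) \<le> 1"
proof -
  have "(norm (sph_vec \<iota> \<theta> \<phi>))\<^sup>2 = (\<Sum>k\<in>range \<iota>. (sph k \<theta> \<phi>)\<^sup>2)"
    using sum.reindex[OF assms(1), of "\<lambda>k. (sph k \<theta> \<phi>)\<^sup>2"]
    by (simp add: norm_vec_def L2_set_def sph_vec_def sum_nonneg o_def)
  also have "\<dots> \<le> (\<Sum>k<3. (sph k \<theta> \<phi>)\<^sup>2)"
    using assms by (intro sum_mono2) auto
  finally show ?thesis by (simp add: sum_sph_squares abs_square_le_1)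
qed

lemma has_vector_derivative_vec_lambda:
  fixes f :: "'n::finite \<Rightarrow> real \<Rightarrow> real"
  assumes "\<And>i. (f i has_real_derivative f' i) (at s)"
  shows "((\<lambda>s. \<chi> i. f i s) has_vector_derivative (\<chi> i. f' i)) (at s)"
  unfolding has_vector_derivative_def
  using assms[unfolded has_field_derivative_def]
  by (subst has_derivative_componentwise_within)
     (auto simp: Basis_vec_def inner_axis mult_commute_abs)

lemma
  fixes x :: "real^'n::finite"
  shows sph_vec_deriv_polar: "((\<lambda>\<theta>. x + r *\<^sub>R sph_vec \<iota> \<theta> \<phi>) has_vector_derivative
      r *\<^sub>R (\<chi> i. sph_polar (\<iota> i) \<theta> \<phi>)) (at \<theta>)"
    and sph_vec_deriv_azim: "((\<lambda>\<phi>. x + r *\<^sub>R sph_vec \<iota> \<theta> \<phi>) has_vector_derivative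
      r *\<^sub>R (\<chi> i. sin \<theta> * sph_azim (\<iota> i) \<phi>)) (at \<phi>)"
  unfolding sph_vec_def
  by (auto intro!: derivative_eq_intros has_vector_derivative_vec_lambda sph_deriv_polar sph_deriv_azim)

lemma continuous_on_halfspace_compose:
  fixes w :: "real^'n::finite \<Rightarrow> real \<Rightarrow> real"
  assumes "continuous_on (UNIV \<times> {0..}) (\<lambda>z. w (fst z) (snd z))"
    and "continuous_on S a" "continuous_on S b" "\<And>y. y \<in> S \<Longrightarrow> b y \<ge> 0"
  shows "continuous_on S (\<lambda>y. w (a y) (b y))"
  by (rule continuous_on_compose2[OF assms(1), of S "\<lambda>y. (a y, b y)", simplified])
     (use assms in \<open>auto intro!: continuous_intros\<close>)

text \<open>The parameter rectangle of polar and azimuthal angle; the area element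
  \<open>sin (fst z)\<close> is written out in each integrand.\<close>

abbreviation sph_box :: "(real \<times> real) set" where
  "sph_box \<equiv> cbox (0, 0) (pi, 2 * pi)"

abbreviation sph_pt :: "('n \<Rightarrow> nat) \<Rightarrow> real \<times> real \<Rightarrow> real^'n::finite" where
  "sph_pt \<iota> z \<equiv> sph_vec \<iota> (fst z) (snd z)"

lemma integral_sph_box_sin: "integral sph_box (\<lambda>z. sin (fst z)) = 4 * pi"
proof -
  have "integral sph_box (\<lambda>z. sin (fst z)) = integral (cbox 0 pi) (\<lambda>\<theta>. integral (cbox 0 (2 * pi)) (\<lambda>\<phi>. sin \<theta>))"
    by (subst integral_prod_continuous) (auto intro!: continuous_intros)
  also have "\<dots> = integral {0..pi} (\<lambda>\<theta>. 2 * pi * sin \<theta>)" by simp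
  also have "\<dots> = 2 * pi * (- cos pi) - 2 * pi * (- cos 0)"
  proof (intro integral_unique fundamental_theorem_of_calculus)
    show "((\<lambda>x. 2 * pi * - cos x) has_vector_derivative 2 * pi * sin x) (at x within {0..pi})" for x
      unfolding has_real_derivative_iff_has_vector_derivative[symmetric]
      by (auto intro!: derivative_eq_intros)
  qed auto
  finally show ?thesis by simp
qed

text \<open>For \<open>G\<close> the gradient and \<open>H\<close> the Hessian of a function this
  says that \<open>2 u_r + r u_rr\<close> and \<open>r\<close> times the Laplacian have the same
  integral over the sphere: the spherical Laplacian integrates to zero. It turns the radial terms in
  the derivative of the Kirchhoff mean into the Laplacian.\<close>

lemma sphere_divergence:
  fixes G :: "'n::finite \<Rightarrow> real^'n \<Rightarrow> real" and H :: "'n \<Rightarrow> 'n \<Rightarrow> real^'n \<Rightarrow> real"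
  assumes \<iota>: "inj \<iota>" "range \<iota> \<subseteq> {..<3}"
    and chain: "\<And>i c c' s. (c has_vector_derivative c') (at s) \<Longrightarrow>
      ((\<lambda>s. G i (c s)) has_real_derivative (\<Sum>j\<in>UNIV. c' $ j * H i j (c s))) (at s)"
    and contG: "\<And>i. continuous_on UNIV (G i)" and contH: "\<And>i j. continuous_on UNIV (H i j)"
  shows "integral sph_box (\<lambda>z. sin (fst z) * (2 * (\<Sum>i\<in>UNIV. sph_pt \<iota> z $ i * G i (x + r *\<^sub>R sph_pt \<iota> z))
       + r * (\<Sum>i\<in>UNIV. sph_pt \<iota> z $ i * (\<Sum>j\<in>UNIV. sph_pt \<iota> z $ j * H i j (x + r *\<^sub>R sph_pt \<iota> z)))))
     = integral sph_box (\<lambda>z. sin (fst z) * (r * (\<Sum>i\<in>UNIV. H i i (x + r *\<^sub>R sph_pt \<iota> z))))"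
    (is "integral _ ?L = integral _ ?R")
proof -
  text \<open>\<open>f1\<close> and \<open>f2\<close> are the \<open>\<theta>\<close>- and \<open>\<phi>\<close>-derivatives below, each of integral zero; their sum is
    \<open>sin \<theta>\<close> times the spherical Laplacian of the restriction to the sphere, divided by \<open>r\<close>. The
    remaining part of the Laplacian follows because point, polar and azimuthal vectors are orthonormal.\<close>
  define y where "y \<theta> \<phi> = x + r *\<^sub>R sph_vec \<iota> \<theta> \<phi>" for \<theta> \<phi>
  define f1 where "f1 \<theta> \<phi> = (\<Sum>i\<in>UNIV. cos \<theta> * (sph_polar (\<iota> i) \<theta> \<phi> * G i (y \<theta> \<phi>)) +
     sin \<theta> * (- sph (\<iota> i) \<theta> \<phi> * G i (y \<theta> \<phi>) +
       sph_polar (\<iota> i) \<theta> \<phi> * (r * (\<Sum>j\<in>UNIV. sph_polar (\<iota> j) \<theta> \<phi> * H i j (y \<theta> \<phi>)))))" for \<theta> \<phi>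
  define f2 where "f2 \<theta> \<phi> = (\<Sum>i\<in>UNIV.
     - (sin \<theta> * sph (\<iota> i) \<theta> \<phi> + cos \<theta> * sph_polar (\<iota> i) \<theta> \<phi>) * G i (y \<theta> \<phi>) +
       sph_azim (\<iota> i) \<phi> * (r * sin \<theta> * (\<Sum>j\<in>UNIV. sph_azim (\<iota> j) \<phi> * H i j (y \<theta> \<phi>))))" for \<theta> \<phi>
  have conty [continuous_intros]: "continuous_on S (\<lambda>z. y (f z) (g z))"
    if "continuous_on S f" "continuous_on S g" for S :: "(real \<times> real) set" and f g
    unfolding y_def using that by (intro continuous_intros)
  have contGy [continuous_intros]: "continuous_on S (\<lambda>z. G i (y (f z) (g z)))"
    if "continuous_on S f" "continuous_on S g" for S :: "(real \<times> real) set" and f g i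
    by (rule continuous_on_compose2[OF contG]) (use that in \<open>auto intro!: continuous_intros\<close>)
  have contHy [continuous_intros]: "continuous_on S (\<lambda>z. H i j (y (f z) (g z)))"
    if "continuous_on S f" "continuous_on S g" for S :: "(real \<times> real) set" and f g i j
    by (rule continuous_on_compose2[OF contH]) (use that in \<open>auto intro!: continuous_intros\<close>)
  have cont1: "continuous_on S (\<lambda>z. f1 (fst z) (snd z))" for S
    unfolding f1_def by (intro continuous_intros)
  have cont2: "continuous_on S (\<lambda>z. f2 (fst z) (snd z))" for S
    unfolding f2_def by (intro continuous_intros)
  have d1: "((\<lambda>\<theta>. \<Sum>i\<in>UNIV. sin \<theta> * (sph_polar (\<iota> i) \<theta> \<phi> * G i (y \<theta> \<phi>))) has_real_derivative f1 \<theta> \<phi>) (at \<theta>)" for \<theta> \<phi>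
  proof -
    have "((\<lambda>\<theta>. G i (y \<theta> \<phi>)) has_real_derivative
        r * (\<Sum>j\<in>UNIV. sph_polar (\<iota> j) \<theta> \<phi> * H i j (y \<theta> \<phi>))) (at \<theta>)" for i
      using chain[OF sph_vec_deriv_polar] by (simp add: y_def sum_distrib_left mult.assoc)
    then show ?thesis
      unfolding f1_def
      by (intro DERIV_sum) (auto intro!: derivative_eq_intros sph_polar_deriv simp: algebra_simps)
  qed
  have d2: "((\<lambda>\<phi>. \<Sum>i\<in>UNIV. sph_azim (\<iota> i) \<phi> * G i (y \<theta> \<phi>)) has_real_derivative f2 \<theta> \<phi>) (at \<phi>)" for \<theta> \<phi>
  proof -
    have "((\<lambda>\<phi>. G i (y \<theta> \<phi>)) has_real_derivative
        r * sin \<theta> * (\<Sum>j\<in>UNIV. sph_azim (\<iota> j) \<phi> * H i j (y \<theta> \<phi>))) (at \<phi>)" for i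
      using chain[OF sph_vec_deriv_azim] by (simp add: y_def sum_distrib_left mult_ac)
    then show ?thesis
      unfolding f2_def
      by (intro DERIV_sum) (auto intro!: derivative_eq_intros sph_azim_deriv[of _ \<theta>] simp: algebra_simps)
  qed
  have "integral sph_box (\<lambda>z. f1 (fst z) (snd z)) = integral (cbox 0 pi) (\<lambda>\<theta>. integral (cbox 0 (2 * pi)) (f1 \<theta>))"
    by (subst integral_prod_continuous[OF cont1]) simp
  also have "\<dots> = integral (cbox 0 (2 * pi)) (\<lambda>\<phi>. integral (cbox 0 pi) (\<lambda>\<theta>. f1 \<theta> \<phi>))"
    using cont1 by (intro integral_swap_continuous) (simp add: case_prod_unfold)
  also have "\<dots> = 0"
  proof -
    \<comment> \<open>Both boundary terms vanish because \<open>sin\<close> is zero at the two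
      poles.\<close>
    have "((\<lambda>\<theta>. f1 \<theta> \<phi>) has_integral
        (\<Sum>i\<in>UNIV. sin pi * (sph_polar (\<iota> i) pi \<phi> * G i (y pi \<phi>)))
        - (\<Sum>i\<in>UNIV. sin 0 * (sph_polar (\<iota> i) 0 \<phi> * G i (y 0 \<phi>)))) {0..pi}" for \<phi>
      by (rule fundamental_theorem_of_calculus)
         (auto intro!: has_field_derivative_at_within d1 simp: has_real_derivative_iff_has_vector_derivative[symmetric])
    then have "integral (cbox 0 pi) (\<lambda>\<theta>. f1 \<theta> \<phi>) = 0" for \<phi>
      by (simp add: integral_unique)
    then show ?thesis by simp
  qed
  finally have i1: "integral sph_box (\<lambda>z. f1 (fst z) (snd z)) = 0" .
  have "integral sph_box (\<lambda>z. f2 (fst z) (snd z)) = integral (cbox 0 pi) (\<lambda>\<theta>. integral (cbox 0 (2 * pi)) (f2 \<theta>))"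
    by (subst integral_prod_continuous[OF cont2]) simp
  also have "\<dots> = 0"
  proof -
    have "(f2 \<theta> has_integral
        (\<Sum>i\<in>UNIV. sph_azim (\<iota> i) (2 * pi) * G i (y \<theta> (2 * pi)))
        - (\<Sum>i\<in>UNIV. sph_azim (\<iota> i) 0 * G i (y \<theta> 0))) {0..2 * pi}" for \<theta>
      by (rule fundamental_theorem_of_calculus)
         (auto intro!: has_field_derivative_at_within d2 simp: has_real_derivative_iff_has_vector_derivative[symmetric])
    \<comment> \<open>Periodicity in the azimuth makes the boundary terms cancel.\<close>
    moreover have "y \<theta> (2 * pi) = y \<theta> 0" "sph_azim k (2 * pi) = sph_azim k 0" for \<theta> k
      by (auto simp: y_def sph_vec_def sph_def sph_azim_def)
    ultimately have "integral (cbox 0 (2 * pi)) (f2 \<theta>) = 0" for \<theta>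
      by (simp add: integral_unique)
    then show ?thesis by simp
  qed
  finally have i2: "integral sph_box (\<lambda>z. f2 (fst z) (snd z)) = 0" .
  have L: "?L = (\<lambda>z. sin (fst z) * (2 * (\<Sum>i\<in>UNIV. sph (\<iota> i) (fst z) (snd z) * G i (y (fst z) (snd z)))
       + r * (\<Sum>i\<in>UNIV. sph (\<iota> i) (fst z) (snd z) * (\<Sum>j\<in>UNIV. sph (\<iota> j) (fst z) (snd z) * H i j (y (fst z) (snd z))))))"
    by (simp add: y_def sph_vec_def)
  have id: "?R z = ?L z + (f1 (fst z) (snd z) + f2 (fst z) (snd z))" for z
  proof -
    obtain \<theta> \<phi> where z: "z = (\<theta>, \<phi>)" by fastforce
    have tr: "H i i v = sph (\<iota> i) \<theta> \<phi> * (\<Sum>j\<in>UNIV. sph (\<iota> j) \<theta> \<phi> * H i j v)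
      + sph_polar (\<iota> i) \<theta> \<phi> * (\<Sum>j\<in>UNIV. sph_polar (\<iota> j) \<theta> \<phi> * H i j v)
      + sph_azim (\<iota> i) \<phi> * (\<Sum>j\<in>UNIV. sph_azim (\<iota> j) \<phi> * H i j v)" for i v
    proof -
      have "H i i v = (\<Sum>j\<in>UNIV. (if \<iota> i = \<iota> j then 1 else 0) * H i j v)"
        using \<iota>(1) by (simp add: inj_eq if_distrib[of "\<lambda>x. x * _"] cong: if_cong)
      also have "\<dots> = (\<Sum>j\<in>UNIV. (sph (\<iota> i) \<theta> \<phi> * sph (\<iota> j) \<theta> \<phi> + sph_polar (\<iota> i) \<theta> \<phi> * sph_polar (\<iota> j) \<theta> \<phi>
          + sph_azim (\<iota> i) \<phi> * sph_azim (\<iota> j) \<phi>) * H i j v)"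
        using \<iota>(2) by (subst sph_orthonormal) auto
      finally show ?thesis by (simp add: algebra_simps sum.distrib sum_distrib_left)
    qed
    show ?thesis
      unfolding f1_def f2_def y_def z fst_conv snd_conv
      by (subst tr) (simp add: sph_vec_def sum_distrib_left sum.distrib algebra_simps sum_subtractf sum_negf)
  qed
  have "?L integrable_on sph_box"
    unfolding L by (intro integrable_continuous continuous_intros)
  moreover have "(\<lambda>z. f1 (fst z) (snd z)) integrable_on sph_box" "(\<lambda>z. f2 (fst z) (snd z)) integrable_on sph_box"
    by (intro integrable_continuous cont1 cont2)+
  ultimately have "integral sph_box ?R = integral sph_box ?L +
      (integral sph_box (\<lambda>z. f1 (fst z) (snd z)) + integral sph_box (\<lambda>z. f2 (fst z) (snd z)))"
    unfolding id by (simp only: integral_add integrable_add)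
  then show ?thesis using i1 i2 by simp
qed

section \<open>Kirchhoff means\<close>

text \<open>Kirchhoff's integrand on the sphere of radius \<open>r\<close> of the backward light cone with vertex
  \<open>(x, t)\<close>; not normalised, so its value at \<open>r = 0\<close> is \<open>4 * pi * u x t\<close>.\<close>

definition kirchhoff_mean :: "('n::finite \<Rightarrow> nat) \<Rightarrow> (real^'n \<Rightarrow> real \<Rightarrow> real) \<Rightarrow> real^'n \<Rightarrow> real \<Rightarrow> real \<Rightarrow> real" where
  "kirchhoff_mean \<iota> u x t r = integral sph_box (\<lambda>z. sin (fst z) *
     (u (x + r *\<^sub>R sph_pt \<iota> z) (t - r)
      + r * (\<Sum>i\<in>UNIV. sph_pt \<iota> z $ i * pdx_st i u (x + r *\<^sub>R sph_pt \<iota> z) (t - r))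
      + r * pdt_st u (x + r *\<^sub>R sph_pt \<iota> z) (t - r)))"

context
  fixes \<iota> :: "'n::finite \<Rightarrow> nat" and u :: "real^'n \<Rightarrow> real \<Rightarrow> real" and x :: "real^'n" and t :: real
  assumes \<iota>: "inj \<iota>" "range \<iota> \<subseteq> {..<3}" and u: "Ck_halfspace 2 u"
begin

lemma continuous_on_light_cone:
  fixes w :: "real^'n \<Rightarrow> real \<Rightarrow> real"
  assumes "continuous_on (UNIV \<times> {0..}) (\<lambda>z. w (fst z) (snd z))" "S \<subseteq> {..t}"
  shows "continuous_on (S \<times> T) (\<lambda>y. w (x + fst y *\<^sub>R sph_pt \<iota> (snd y)) (t - fst y))"
  by (rule continuous_on_halfspace_compose[OF assms(1)]) (use assms(2) in \<open>auto intro!: continuous_intros\<close>)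

lemma continuous_on_light_cone_slice:
  fixes w :: "real^'n \<Rightarrow> real \<Rightarrow> real"
  assumes "continuous_on (UNIV \<times> {0..}) (\<lambda>z. w (fst z) (snd z))" "r \<le> t"
  shows "continuous_on T (\<lambda>z. w (x + r *\<^sub>R sph_pt \<iota> z) (t - r))"
  by (rule continuous_on_halfspace_compose[OF assms(1)]) (use assms(2) in \<open>auto intro!: continuous_intros\<close>)

lemma continuous_on_kirchhoff_mean: "continuous_on {0..t} (kirchhoff_mean \<iota> u x t)"
proof -
  note u1 = Ck_halfspace_continuous[OF Ck_halfspace_2D(1)[OF u]]
  note * = u1[THEN continuous_on_light_cone[where S = "{0..t}" and T = sph_box]]
  show ?thesis
    unfolding kirchhoff_mean_def[abs_def]
    by (rule integral_continuous_on_param, unfold case_prod_unfold)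
       (intro continuous_intros *; auto)
qed

lemma kirchhoff_mean_0: "kirchhoff_mean \<iota> u x t 0 = 4 * pi * u x t"
proof -
  have "kirchhoff_mean \<iota> u x t 0 = integral sph_box (\<lambda>z. sin (fst z) * u x t)"
    by (simp add: kirchhoff_mean_def)
  also have "\<dots> = integral sph_box (\<lambda>z. sin (fst z)) * u x t"
    by (rule integral_mult_left)
  finally show ?thesis by (simp add: integral_sph_box_sin)
qed

text \<open>Along each ray of the backward light cone the first time derivatives and the mixed
  derivatives cancel. What is left is \<open>2 u_r + r u_rr - r u_tt\<close>, whose spatial part
  integrates to \<open>r\<close> times the Laplacian.\<close>

lemma DERIV_kirchhoff_mean:
  assumes r: "0 < r" "r < t"
  shows "(kirchhoff_mean \<iota> u x t has_real_derivative - r * integral sph_box (\<lambda>z. sin (fst z) *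
     (pdt_st (pdt_st u) (x + r *\<^sub>R sph_pt \<iota> z) (t - r)
      - (\<Sum>i\<in>UNIV. pdx_st i (pdx_st i u) (x + r *\<^sub>R sph_pt \<iota> z) (t - r))))) (at r)"
proof -
  note C = Ck_halfspace_2D[OF u]
  note cont = Ck_halfspace_continuous[OF C(1)] Ck_halfspace_continuous[OF C(2)] Ck_halfspace_continuous[OF C(3)]
  define p where "p r z = sin (fst z) *
     (u (x + r *\<^sub>R sph_pt \<iota> z) (t - r)
      + r * (\<Sum>i\<in>UNIV. sph_pt \<iota> z $ i * pdx_st i u (x + r *\<^sub>R sph_pt \<iota> z) (t - r))
      + r * pdt_st u (x + r *\<^sub>R sph_pt \<iota> z) (t - r))" for r z
  \<comment> \<open>The derivative of the integrand \<open>p\<close> is \<open>q - q'\<close>, with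
    \<open>q\<close> the spatial and \<open>q'\<close> the temporal second-order part;
    \<open>l\<close> is the Laplacian that replaces \<open>q\<close> under the integral.\<close>
  define q where "q r z = sin (fst z) *
     (2 * (\<Sum>i\<in>UNIV. sph_pt \<iota> z $ i * pdx_st i u (x + r *\<^sub>R sph_pt \<iota> z) (t - r))
      + r * (\<Sum>i\<in>UNIV. sph_pt \<iota> z $ i *
          (\<Sum>j\<in>UNIV. sph_pt \<iota> z $ j * pdx_st j (pdx_st i u) (x + r *\<^sub>R sph_pt \<iota> z) (t - r))))" for r z
  define q' where "q' r z = sin (fst z) * (r * pdt_st (pdt_st u) (x + r *\<^sub>R sph_pt \<iota> z) (t - r))" for r z
  define l where "l r z = sin (fst z) * (r * (\<Sum>i\<in>UNIV. pdx_st i (pdx_st i u) (x + r *\<^sub>R sph_pt \<iota> z) (t - r)))" for r z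
  have ray: "((\<lambda>r. w (x + r *\<^sub>R v) (t - r)) has_real_derivative
      (\<Sum>i\<in>UNIV. v $ i * pdx_st i w (x + r *\<^sub>R v) (t - r)) - pdt_st w (x + r *\<^sub>R v) (t - r)) (at r)"
    if "Ck_halfspace 1 w" "r < t" for w v r
  proof -
    have "((\<lambda>r. x + r *\<^sub>R v) has_vector_derivative v) (at r)"
      "((\<lambda>r. t - r) has_real_derivative -1) (at r)"
      by (auto intro!: derivative_eq_intros)
    from Ck_halfspace_chain[OF that(1) this] that(2) show ?thesis by simp
  qed
  have dp: "((\<lambda>r. p r z) has_real_derivative q r z - q' r z) (at r)" if "r < t" for r z
  proof -
    define v where "v = sph_pt \<iota> z"
    let ?w = "\<lambda>w. w (x + r *\<^sub>R v) (t - r)"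
    have "((\<lambda>r. \<Sum>i\<in>UNIV. v $ i * pdx_st i u (x + r *\<^sub>R v) (t - r)) has_real_derivative
        (\<Sum>i\<in>UNIV. v $ i * ((\<Sum>j\<in>UNIV. v $ j * ?w (pdx_st j (pdx_st i u))) - ?w (pdt_st (pdx_st i u))))) (at r)"
      by (intro DERIV_sum DERIV_cmult ray C that)
    note big = DERIV_add[OF DERIV_add[OF ray[OF C(1) that, of v] DERIV_mult[OF DERIV_ident this]]
        DERIV_mult[OF DERIV_ident ray[OF C(3) that, of v]]]
    \<comment> \<open>Here \<open>a\<close> and \<open>b\<close> are the radial and time derivatives
      of \<open>u\<close>, and \<open>d\<close>, \<open>e\<close>, \<open>q\<close> the second
      radial, mixed and second time derivatives.\<close>
    have collect: "(a - b) + (1 * a + (d - e) * r) + (1 * b + (e - q) * r) = 2 * a + r * d - r * q" for a b d e q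
      by (simp add: algebra_simps)
    have comm: "?w (pdt_st (pdx_st i u)) = ?w (pdx_st i (pdt_st u))" for i
      using that by (intro pdt_pdx_commute u) simp
    have "((\<lambda>r. u (x + r *\<^sub>R v) (t - r) + r * (\<Sum>i\<in>UNIV. v $ i * pdx_st i u (x + r *\<^sub>R v) (t - r))
      + r * pdt_st u (x + r *\<^sub>R v) (t - r)) has_real_derivative
       2 * (\<Sum>i\<in>UNIV. v $ i * ?w (pdx_st i u))
         + r * (\<Sum>i\<in>UNIV. v $ i * (\<Sum>j\<in>UNIV. v $ j * ?w (pdx_st j (pdx_st i u)))) - r * ?w (pdt_st (pdt_st u))) (at r)"
      by (rule DERIV_cong[OF big]) (unfold comm right_diff_distrib sum_subtractf, rule collect)
    from DERIV_cmult[OF this, of "sin (fst z)"] show ?thesis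
      unfolding p_def q_def q'_def v_def by (simp add: right_diff_distrib)
  qed
  have slice: "continuous_on sph_box (p s)" "continuous_on sph_box (q s)" "continuous_on sph_box (q' s)"
     "continuous_on sph_box (l s)" if "s < t" for s
    using that unfolding p_def q_def q'_def l_def
    by (intro continuous_intros cont[THEN continuous_on_light_cone_slice]; simp)+
  have "((\<lambda>r. integral sph_box (p r)) has_real_derivative integral sph_box (\<lambda>z. q r z - q' r z)) (at r within {0<..<t})"
  proof (rule leibniz_rule_field_derivative)
    show "((\<lambda>r. p r z) has_real_derivative q r z - q' r z) (at r within {0<..<t})" if "r \<in> {0<..<t}" for r z
      using that by (auto intro: has_field_derivative_at_within[OF dp])
    show "p r integrable_on sph_box" if "r \<in> {0<..<t}" for r
      using that by (intro integrable_continuous slice) auto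
    note * = cont[THEN continuous_on_light_cone[where S = "{0<..<t}" and T = sph_box]]
    show "continuous_on ({0<..<t} \<times> sph_box) (\<lambda>(r, z). q r z - q' r z)"
      unfolding q_def q'_def case_prod_unfold by (intro continuous_intros *; auto)
  qed (use r in auto)
  moreover have "at r within {0<..<t} = at r" using r by (intro at_within_open) auto
  moreover have "integral sph_box (\<lambda>z. q r z - q' r z) = integral sph_box (q r) - integral sph_box (q' r)"
    using r by (intro integral_diff integrable_continuous slice) auto
  moreover have "integral sph_box (q r) = integral sph_box (l r)"
    unfolding q_def l_def
  proof (rule sphere_divergence[OF \<iota>, where G = "\<lambda>i y. pdx_st i u y (t - r)" and H = "\<lambda>i j y. pdx_st j (pdx_st i u) y (t - r)"])
    show "((\<lambda>s. pdx_st i u (c s) (t - r)) has_real_derivative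
        (\<Sum>j\<in>UNIV. c' $ j * pdx_st j (pdx_st i u) (c s) (t - r))) (at s)"
      if "(c has_vector_derivative c') (at s)" for i c c' s
      using Ck_halfspace_chain[OF C(2) that, of "\<lambda>_. t - r" 0] r by simp
    show "continuous_on UNIV (\<lambda>y. pdx_st i u y (t - r))" for i
      by (rule continuous_on_halfspace_compose[OF cont(2)]) (use r in \<open>auto intro!: continuous_intros\<close>)
    show "continuous_on UNIV (\<lambda>y. pdx_st j (pdx_st i u) y (t - r))" for i j
      by (rule continuous_on_halfspace_compose[OF cont(5)]) (use r in \<open>auto intro!: continuous_intros\<close>)
  qed
  moreover have "integral sph_box (l r) - integral sph_box (q' r) = integral sph_box (\<lambda>z. l r z - q' r z)"
    using r by (intro integral_diff[symmetric] integrable_continuous slice) auto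
  moreover have "integral sph_box (\<lambda>z. l r z - q' r z) = integral sph_box (\<lambda>z. - r * (sin (fst z) *
     (pdt_st (pdt_st u) (x + r *\<^sub>R sph_pt \<iota> z) (t - r)
      - (\<Sum>i\<in>UNIV. pdx_st i (pdx_st i u) (x + r *\<^sub>R sph_pt \<iota> z) (t - r)))))"
    by (rule integral_cong) (simp add: l_def q'_def algebra_simps)
  moreover have "\<dots> = - r * integral sph_box (\<lambda>z. sin (fst z) *
     (pdt_st (pdt_st u) (x + r *\<^sub>R sph_pt \<iota> z) (t - r)
      - (\<Sum>i\<in>UNIV. pdx_st i (pdx_st i u) (x + r *\<^sub>R sph_pt \<iota> z) (t - r))))"
    by (rule integral_mult_right)
  ultimately show ?thesis
    unfolding p_def kirchhoff_mean_def[abs_def] by (simp only:)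
qed

end

section \<open>Comparison in the backward cone\<close>

text \<open>If the inequality failed, the points of the truncated cone with \<open>u \<le> w\<close>
  would form a nonempty compact set. At one of its earliest points the inequality still holds at all
  earlier cone points, so \<open>step\<close> gives a contradiction. At \<open>t = a\<close> the
  premise of \<open>step\<close> is vacuous, so \<open>step\<close> also has to supply the initial
  ordering.\<close>

lemma first_crossing_time:
  fixes u :: "'a::{heine_borel,real_normed_vector} \<Rightarrow> real \<Rightarrow> real"
  assumes cont: "continuous_on (UNIV \<times> {0..}) (\<lambda>z. u (fst z) (snd z))" and a: "0 \<le> a"
    and w: "continuous_on {a..b} w"
    and step: "\<And>x t. dist x x0 + t \<le> T \<Longrightarrow> a \<le> t \<Longrightarrow> t \<le> b \<Longrightarrow>
        (\<And>y s. dist y x0 + s \<le> T \<Longrightarrow> a \<le> s \<Longrightarrow> s < t \<Longrightarrow> w s < u y s) \<Longrightarrow> w t < u x t"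
    and xt: "dist x x0 + t \<le> T" "a \<le> t" "t \<le> b"
  shows "w t < u x t"
proof (rule ccontr)
  assume neg: "\<not> w t < u x t"
  define K where "K = {z. dist (fst z) x0 + snd z \<le> T} \<inter> (UNIV \<times> {a..b})"
  define S where "S = K \<inter> (\<lambda>z. u (fst z) (snd z) - w (snd z)) -` {..0}"
  have "closed {z::'a \<times> real. dist (fst z) x0 + snd z \<le> T}"
    by (intro closed_Collect_le continuous_intros)
  then have "closed K"
    unfolding K_def by (intro closed_Int closed_Times) auto
  have "K \<subseteq> cball x0 T \<times> {a..b}"
    using a by (auto simp: K_def dist_commute)
  then have "bounded K"
    by (rule bounded_subset[rotated]) (intro bounded_Times bounded_cball bounded_closed_interval)
  have "continuous_on K (\<lambda>z. u (fst z) (snd z) - w (snd z))"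
    by (intro continuous_intros continuous_on_subset[OF cont] continuous_on_compose2[OF w])
       (use a in \<open>auto simp: K_def\<close>)
  then have "closed S"
    unfolding S_def using \<open>closed K\<close> by (intro continuous_closed_preimage) auto
  moreover have "bounded S"
    using \<open>bounded K\<close> by (rule bounded_subset) (auto simp: S_def)
  ultimately have "compact S" by (simp add: compact_eq_bounded_closed)
  moreover have "(x, t) \<in> S" using neg xt by (auto simp: S_def K_def)
  ultimately obtain z where z: "z \<in> S" "\<And>z'. z' \<in> S \<Longrightarrow> snd z \<le> snd z'"
    using continuous_attains_inf[of S snd] continuous_on_snd[OF continuous_on_id] by blast
  have "w (snd z) < u (fst z) (snd z)"
  proof (rule step)
    show "w s < u y s" if y: "dist y x0 + s \<le> T" "a \<le> s" "s < snd z" for y s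
    proof (rule ccontr)
      assume "\<not> w s < u y s"
      then have "(y, s) \<in> S" using y z(1) by (auto simp: S_def K_def)
      then show False using z(2) y(3) by fastforce
    qed
  qed (use z in \<open>auto simp: S_def K_def\<close>)
  then show False using z(1) by (auto simp: S_def)
qed

context
  fixes \<iota> :: "'n::finite \<Rightarrow> nat" and u :: "real^'n \<Rightarrow> real \<Rightarrow> real"
  assumes \<iota>: "inj \<iota>" "range \<iota> \<subseteq> {..<3}" and u: "Ck_halfspace 2 u"
begin

text \<open>A spatially constant \<open>v\<close> contributes \<open>4 * pi * (v (t - r) + r * v' (t - r))\<close> to the Kirchhoff mean.\<close>

lemma kirchhoff_mean_comparison:
  assumes \<rho>: "0 \<le> \<sigma>" "\<sigma> \<le> \<rho>" "\<rho> \<le> t"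
    and v: "\<And>s. t - \<rho> \<le> s \<Longrightarrow> s \<le> t - \<sigma> \<Longrightarrow> (v has_real_derivative v' s) (at s)"
    and v': "\<And>s. t - \<rho> \<le> s \<Longrightarrow> s \<le> t - \<sigma> \<Longrightarrow> (v' has_real_derivative v'' s) (at s)"
    and box: "\<And>r y. \<sigma> < r \<Longrightarrow> r < \<rho> \<Longrightarrow> dist y x \<le> r \<Longrightarrow>
       v'' (t - r) \<le> pdt_st (pdt_st u) y (t - r) - (\<Sum>i\<in>UNIV. pdx_st i (pdx_st i u) y (t - r))"
  shows "kirchhoff_mean \<iota> u x t \<rho> - 4 * pi * (v (t - \<rho>) + \<rho> * v' (t - \<rho>))
    \<le> kirchhoff_mean \<iota> u x t \<sigma> - 4 * pi * (v (t - \<sigma>) + \<sigma> * v' (t - \<sigma>))"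
proof -
  define D where "D r = kirchhoff_mean \<iota> u x t r - 4 * pi * (v (t - r) + r * v' (t - r))" for r
  have "D \<rho> \<le> D \<sigma>"
  proof (rule DERIV_nonpos_imp_decreasing_open[where f = D])
    have c: "continuous_on {t-\<rho>..t-\<sigma>} v"
      by (rule DERIV_continuous_on[OF has_field_derivative_at_within[OF v]]) auto
    have c': "continuous_on {t-\<rho>..t-\<sigma>} v'"
      by (rule DERIV_continuous_on[OF has_field_derivative_at_within[OF v']]) auto
    show "continuous_on {\<sigma>..\<rho>} D"
      unfolding D_def
      by (intro continuous_intros continuous_on_subset[OF continuous_on_kirchhoff_mean[OF \<iota> u]]
            continuous_on_compose2[OF c] continuous_on_compose2[OF c'])
         (use \<rho> in auto)
  next
    fix r assume r': "\<sigma> < r" "r < \<rho>"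
    then have r: "0 < r" "r < \<rho>" using \<rho> by auto
    define b where "b z = pdt_st (pdt_st u) (x + r *\<^sub>R sph_pt \<iota> z) (t - r)
      - (\<Sum>i\<in>UNIV. pdx_st i (pdx_st i u) (x + r *\<^sub>R sph_pt \<iota> z) (t - r))" for z
    define I where "I = integral sph_box (\<lambda>z. sin (fst z) * b z)"
    have dK: "(kirchhoff_mean \<iota> u x t has_real_derivative - r * I) (at r)"
      unfolding I_def b_def by (rule DERIV_kirchhoff_mean[OF \<iota> u]) (use r \<rho> in auto)
    have shift: "((\<lambda>r. w (t - r)) has_real_derivative - w') (at r)"
      if "(w has_real_derivative w') (at (t - r))" for w w'
    proof -
      have "((\<lambda>r. t - r) has_real_derivative - 1) (at r)" by (auto intro!: derivative_eq_intros)
      from DERIV_chain2[OF that this] show ?thesis by simp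
    qed
    \<comment> \<open>The two \<open>v'\<close> terms cancel, leaving
      \<open>- r * (I - 4 * pi * v'' (t - r))\<close>.\<close>
    have "(D has_real_derivative (- r * I - 4 * pi * (- v' (t - r) + (1 * v' (t - r) + - v'' (t - r) * r)))) (at r)"
      unfolding D_def
      by (rule DERIV_diff[OF dK DERIV_cmult[OF DERIV_add[OF shift[OF v] DERIV_mult[OF DERIV_ident shift[OF v']]]]])
         (use r' in auto)
    moreover have "4 * pi * v'' (t - r) \<le> I"
    proof -
      note C = Ck_halfspace_2D[OF u]
      have "4 * pi * v'' (t - r) = integral sph_box (\<lambda>z. sin (fst z) * v'' (t - r))"
        by (simp add: integral_mult_left integral_sph_box_sin)
      also have "\<dots> \<le> I"
        unfolding I_def
      proof (rule integral_le)
        show "(\<lambda>z. sin (fst z) * v'' (t - r)) integrable_on sph_box"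
          by (intro integrable_continuous continuous_intros)
        show "(\<lambda>z. sin (fst z) * b z) integrable_on sph_box"
          unfolding b_def
          by (intro integrable_continuous continuous_intros
                Ck_halfspace_continuous(2)[OF C(2), THEN continuous_on_light_cone_slice[OF \<iota> u]]
                Ck_halfspace_continuous(3)[OF C(3), THEN continuous_on_light_cone_slice[OF \<iota> u]])
             (use r \<rho> in auto)
        fix z assume z: "z \<in> sph_box"
        \<comment> \<open>In the planar case the projected point may lie inside the ball, which is
          why \<open>box\<close> is assumed on the whole ball.\<close>
        have "dist (x + r *\<^sub>R sph_pt \<iota> z) x \<le> r"
          using norm_sph_vec_le[OF \<iota>, of "fst z" "snd z"] r by (simp add: dist_norm mult_left_le)
        then have "v'' (t - r) \<le> b z"
          unfolding b_def using r' by (intro box) auto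
        moreover have "0 \<le> sin (fst z)"
          using z by (cases z) (auto intro!: sin_ge_zero)
        ultimately show "sin (fst z) * v'' (t - r) \<le> sin (fst z) * b z"
          by (rule mult_left_mono)
      qed
      finally show ?thesis .
    qed
    then have "r * (4 * pi * v'' (t - r)) \<le> r * I"
      using r by (intro mult_left_mono) auto
    then have "(- r * I - 4 * pi * (- v' (t - r) + (1 * v' (t - r) + - v'' (t - r) * r))) \<le> 0"
      by (simp add: algebra_simps)
    ultimately show "\<exists>y. (D has_real_derivative y) (at r) \<and> y \<le> 0" by blast
  qed (use \<rho> in auto)
  then show ?thesis
    by (simp only: D_def)
qed

text \<open>At \<open>r = t\<close> the integrand sees only the data at time 0, and by
  Cauchy-Schwarz its directional derivative is at least minus the norm of the gradient.\<close>

lemma kirchhoff_mean_initial_bound: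
  assumes t: "0 \<le> t"
    and data: "\<And>y. dist y x \<le> t \<Longrightarrow>
       t * M \<le> u y 0 - t * norm (grad (\<lambda>y. u y 0) y) + t * pdt_st u y 0"
  shows "4 * pi * (t * M) \<le> kirchhoff_mean \<iota> u x t t"
proof -
  note cont = Ck_halfspace_continuous[OF Ck_halfspace_2D(1)[OF u]]
  have "4 * pi * (t * M) = integral sph_box (\<lambda>z. sin (fst z) * (t * M))"
    by (simp add: integral_mult_left integral_sph_box_sin)
  also have "\<dots> \<le> kirchhoff_mean \<iota> u x t t"
    unfolding kirchhoff_mean_def
  proof (rule integral_le)
    show "(\<lambda>z. sin (fst z) * (t * M)) integrable_on sph_box"
      by (intro integrable_continuous continuous_intros)
    show "(\<lambda>z. sin (fst z) * (u (x + t *\<^sub>R sph_pt \<iota> z) (t - t)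
      + t * (\<Sum>i\<in>UNIV. sph_pt \<iota> z $ i * pdx_st i u (x + t *\<^sub>R sph_pt \<iota> z) (t - t))
      + t * pdt_st u (x + t *\<^sub>R sph_pt \<iota> z) (t - t))) integrable_on sph_box"
      by (intro integrable_continuous continuous_intros cont[THEN continuous_on_light_cone_slice[OF \<iota> u]] order_refl)
    fix z assume z: "z \<in> sph_box"
    define y where "y = x + t *\<^sub>R sph_pt \<iota> z"
    have n: "norm (sph_pt \<iota> z :: real^'n) \<le> 1" by (rule norm_sph_vec_le[OF \<iota>])
    have "dist y x \<le> t"
      using n t by (simp add: y_def dist_norm mult_left_le)
    then have "t * M \<le> u y 0 - t * norm (grad (\<lambda>y. u y 0) y) + t * pdt_st u y 0"
      by (rule data)
    moreover have "- norm (grad (\<lambda>y. u y 0) y) \<le> (\<Sum>i\<in>UNIV. sph_pt \<iota> z $ i * pdx_st i u y 0)"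
    proof -
      have "(\<Sum>i\<in>UNIV. sph_pt \<iota> z $ i * pdx_st i u y 0) = sph_pt \<iota> z \<bullet> grad (\<lambda>y. u y 0) y"
        by (simp add: inner_vec_def grad_def pdx_st_def pdx_def)
      moreover have "\<bar>sph_pt \<iota> z \<bullet> grad (\<lambda>y. u y 0) y\<bar> \<le> 1 * norm (grad (\<lambda>y. u y 0) y)"
        using Cauchy_Schwarz_ineq2 n by (rule order_trans[OF _ mult_right_mono]) auto
      ultimately show ?thesis by linarith
    qed
    then have "t * - norm (grad (\<lambda>y. u y 0) y) \<le> t * (\<Sum>i\<in>UNIV. sph_pt \<iota> z $ i * pdx_st i u y 0)"
      using t by (rule mult_left_mono)
    ultimately have "t * M \<le> u y 0 + t * (\<Sum>i\<in>UNIV. sph_pt \<iota> z $ i * pdx_st i u y 0) + t * pdt_st u y 0"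
      by simp
    moreover have "0 \<le> sin (fst z)"
      using z by (cases z) (auto intro!: sin_ge_zero)
    ultimately show "sin (fst z) * (t * M) \<le> sin (fst z) * (u (x + t *\<^sub>R sph_pt \<iota> z) (t - t)
      + t * (\<Sum>i\<in>UNIV. sph_pt \<iota> z $ i * pdx_st i u (x + t *\<^sub>R sph_pt \<iota> z) (t - t))
      + t * pdt_st u (x + t *\<^sub>R sph_pt \<iota> z) (t - t))"
      unfolding y_def diff_self by (rule mult_left_mono)
  qed
  finally show ?thesis .
qed

text \<open>The hypotheses on \<open>v\<close> and \<open>v'\<close> at \<open>a\<close> say that
  the tangent line of \<open>v\<close> there lies below \<open>M * t\<close> for all
  \<open>t \<ge> a\<close>. This tangent line is what \<open>v\<close> contributes to the Kirchhoff
  mean at radius \<open>t - a\<close>, so \<open>v\<close> can be started at time \<open>a\<close>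
  without any bound on the derivatives of \<open>u\<close> at that time.\<close>

lemma blowup_in_cone:
  assumes wave: "\<And>x t. t \<ge> 0 \<Longrightarrow>
      pdt_st (pdt_st u) x t - (\<Sum>i\<in>UNIV. pdx_st i (pdx_st i u) x t) = F (u x t)"
    and F: "\<And>s. s \<ge> 0 \<Longrightarrow> F s \<ge> A * s powr p"
    and A: "A > 0" and p: "p > 1" and T: "T > 0" and M: "M > 0"
    and pos: "\<And>y. dist y x0 \<le> T \<Longrightarrow> u y 0 > 0"
    and data: "\<And>y s. dist y x0 \<le> T \<Longrightarrow> 0 \<le> s \<Longrightarrow> s \<le> T \<Longrightarrow>
       s * M \<le> u y 0 - s * norm (grad (\<lambda>y. u y 0) y) + s * pdt_st u y 0"
    and a: "0 \<le> a" "a \<le> b" "b \<le> T"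
    and v: "\<And>s. a \<le> s \<Longrightarrow> s \<le> b \<Longrightarrow> (v has_real_derivative v' s) (at s)"
    and v': "\<And>s. a \<le> s \<Longrightarrow> s \<le> b \<Longrightarrow> (v' has_real_derivative v'' s) (at s)"
    and v'': "\<And>s. a \<le> s \<Longrightarrow> s \<le> b \<Longrightarrow> 0 \<le> v s \<and> v'' s \<le> A * v s powr p"
    and va: "v a < M * a" "v' a \<le> M"
  shows "v b < u x0 b"
proof -
  note cont = Ck_halfspace_continuous(1)[OF Ck_halfspace_2D(1)[OF u]]
  have inside: "dist y x0 + (t - r) \<le> T" if "dist y x \<le> r" "dist x x0 + t \<le> T" for x y and r t :: real
    using that dist_triangle[of y x0 x] by linarith
  have init: "4 * pi * (t * M) \<le> kirchhoff_mean \<iota> u x t t" if "dist x x0 + t \<le> T" "0 \<le> t" for x t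
  proof (rule kirchhoff_mean_initial_bound[OF that(2)])
    fix y assume "dist y x \<le> t"
    with inside[OF this that(1)] that show "t * M \<le> u y 0 - t * norm (grad (\<lambda>y. u y 0) y) + t * pdt_st u y 0"
      by (intro data) (auto intro: order_trans[OF _ that(1)])
  qed
  \<comment> \<open>Comparison with the zero profile: while \<open>u\<close> is positive at earlier
    points of the cone, \<open>F\<close> is nonnegative there and the mean does not increase with
    the radius.\<close>
  have mono: "kirchhoff_mean \<iota> u x t t \<le> kirchhoff_mean \<iota> u x t \<rho>"
    if "0 \<le> \<rho>" "\<rho> \<le> t" and nonneg: "\<And>y s. dist y x0 + s \<le> T \<Longrightarrow> 0 \<le> s \<Longrightarrow> s < t \<Longrightarrow> 0 < u y s"
      and x: "dist x x0 + t \<le> T" for x t \<rho>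
  proof -
    have "0 \<le> pdt_st (pdt_st u) y (t - r) - (\<Sum>i\<in>UNIV. pdx_st i (pdx_st i u) y (t - r))"
      if r: "\<rho> < r" "r < t" "dist y x \<le> r" for r y
    proof -
      have "0 < u y (t - r)"
        using inside[OF r(3) x] r \<open>0 \<le> \<rho>\<close> by (intro nonneg) auto
      then have "0 \<le> A * u y (t - r) powr p" "A * u y (t - r) powr p \<le> F (u y (t - r))"
        using F[of "u y (t - r)"] A by auto
      then show ?thesis using wave[of "t - r" y] r by simp
    qed
    from kirchhoff_mean_comparison[where v = "\<lambda>_. 0" and v' = "\<lambda>_. 0" and v'' = "\<lambda>_. 0", OF that(1,2) order_refl _ _ this]
    show ?thesis by simp
  qed
  have pos_cone: "0 < u x t" if "dist x x0 + t \<le> T" "0 \<le> t" for x t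
  proof (rule first_crossing_time[where u = u and x = x and t = t and w = "\<lambda>_. 0" and a = 0 and b = t and T = T and x0 = x0])
    fix x t assume x: "dist x x0 + t \<le> T" "0 \<le> t"
      and before: "\<And>y s. dist y x0 + s \<le> T \<Longrightarrow> 0 \<le> s \<Longrightarrow> s < t \<Longrightarrow> 0 < u y s"
    show "0 < u x t"
    \<comment> \<open>At time 0 the bound \<open>t * M\<close> is zero, so strict positivity has to
      come from the data.\<close>
    proof (cases "t = 0")
      case True
      then show ?thesis using pos x by simp
    next
      case False
      have "4 * pi * (t * M) \<le> 4 * pi * u x t"
        using order_trans[OF init[OF x] mono[OF order_refl x(2) before x(1)]]
        by (simp only: kirchhoff_mean_0[OF \<iota> u] mult.assoc)
      then have "t * M \<le> u x t" by simp
      moreover have "0 < t * M" using False x M by simp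
      ultimately show ?thesis by linarith
    qed
  qed (use that cont in auto)
  show ?thesis
  proof (rule first_crossing_time[where u = u and x = x0 and t = b and a = a and w = v and b = b and T = T and x0 = x0])
    show "continuous_on {a..b} v"
      by (rule DERIV_continuous_on[OF has_field_derivative_at_within[OF v]]) auto
    fix x t assume x: "dist x x0 + t \<le> T" "a \<le> t" "t \<le> b"
      and before: "\<And>y s. dist y x0 + s \<le> T \<Longrightarrow> a \<le> s \<Longrightarrow> s < t \<Longrightarrow> v s < u y s"
    have t: "0 \<le> t" "0 \<le> t - a" "t - a \<le> t" using x a by auto
    \<comment> \<open>Only radii below \<open>t - a\<close>, that is times after \<open>a\<close>,
      are compared with \<open>v\<close>; the radii from \<open>t - a\<close> to \<open>t\<close>
      are handled by positivity alone.\<close>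
    have "v'' (t - r) \<le> pdt_st (pdt_st u) y (t - r) - (\<Sum>i\<in>UNIV. pdx_st i (pdx_st i u) y (t - r))"
      if r: "0 < r" "r < t - a" "dist y x \<le> r" for r y
    proof -
      have v: "0 \<le> v (t - r)" "v'' (t - r) \<le> A * v (t - r) powr p"
        using v''[of "t - r"] r x by auto
      have "v (t - r) < u y (t - r)"
        using inside[OF r(3) x(1)] r by (intro before) auto
      then have "A * v (t - r) powr p \<le> A * u y (t - r) powr p"
        using v A p by (intro mult_left_mono powr_mono2) auto
      also have "\<dots> \<le> F (u y (t - r))"
        using v \<open>v (t - r) < u y (t - r)\<close> by (intro F) auto
      finally show ?thesis using wave[of "t - r" y] r a v by simp
    qed
    from kirchhoff_mean_comparison[where v = v and v' = v' and v'' = v'', OF order_refl t(2,3) _ _ this]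
    have "kirchhoff_mean \<iota> u x t (t - a) - 4 * pi * (v a + (t - a) * v' a) \<le> 4 * pi * u x t - 4 * pi * v t"
      using v v' x by (simp add: kirchhoff_mean_0[OF \<iota> u])
    moreover have "kirchhoff_mean \<iota> u x t t \<le> kirchhoff_mean \<iota> u x t (t - a)"
      by (rule mono[OF t(2,3) _ x(1)]) (rule pos_cone)
    moreover have "4 * pi * (t * M) \<le> kirchhoff_mean \<iota> u x t t"
      by (rule init[OF x(1) t(1)])
    moreover have "4 * pi * (v a + (t - a) * v' a) < 4 * pi * (t * M)"
    proof -
      have "(t - a) * v' a \<le> (t - a) * M" using va t by (intro mult_left_mono) auto
      then have "v a + (t - a) * v' a < t * M" using va by (simp add: algebra_simps)
      then show ?thesis by simp
    qed
    ultimately have "4 * pi * v t < 4 * pi * u x t" by linarith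
    then show "v t < u x t" by simp
  qed (use a T cont in auto)
qed

end

text \<open>The profile \<open>v s = B * (T - s) powr - k\<close> solves \<open>v'' = A * v powr p\<close>. At time \<open>T / 2\<close> its
  value and slope are of order \<open>T powr - k\<close> and \<open>T powr (- k - 1)\<close>, hence for large \<open>T\<close> smaller than
  those of \<open>s * C / (1 + 3 * T) powr (1 + \<kappa>)\<close>: this is where \<open>\<kappa> < 2 / (p - 1)\<close> enters.\<close>

lemma blowup_profile_dominated:
  fixes A C p \<kappa> N :: real
  assumes A: "A > 0" and C: "C > 0" and p: "p > 1" and \<kappa>: "0 < \<kappa>" "\<kappa> < 2 / (p - 1)"
  obtains T B k where "T \<ge> N" "T \<ge> 1" "B > 0" "k > 0"
    "k * p = k + 2" "B * k * (k + 1) = A * B powr p"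
    "B * (T / 2) powr - k < C / (1 + 3 * T) powr (1 + \<kappa>) * (T / 2)"
    "B * k * (T / 2) powr (- k - 1) \<le> C / (1 + 3 * T) powr (1 + \<kappa>)"
proof -
  \<comment> \<open>\<open>k\<close> matches the exponents \<open>k + 2\<close> and
    \<open>k * p\<close> of the two sides of the equation; \<open>B\<close> then matches the
    coefficients.\<close>
  define k where "k = 2 / (p - 1)"
  define B where "B = (k * (k + 1) / A) powr (1 / (p - 1))"
  \<comment> \<open>With \<open>T = 2 * y\<close> and \<open>y \<ge> 1\<close> one has
    \<open>1 + 3 * T \<le> 8 * y\<close>; this is the origin of the 8.\<close>
  define c where "c = C / 8 powr (1 + \<kappa>)"
  have k: "k > 0" "k * p = k + 2" "\<kappa> < k" using p \<kappa> by (auto simp: k_def field_simps)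
  have B: "B > 0" using k A by (simp add: B_def)
  have "B powr p = B powr (1 + (p - 1))" by simp
  also have "\<dots> = B * B powr (p - 1)" unfolding powr_add using B by simp
  also have "B powr (p - 1) = k * (k + 1) / A"
    unfolding B_def powr_powr using p k A by simp
  finally have Bp: "B * k * (k + 1) = A * B powr p" using A by simp
  have c: "c > 0" using C by (simp add: c_def)
  have "((\<lambda>y. y powr (\<kappa> - k)) \<longlongrightarrow> 0) at_top"
    using k by (intro tendsto_neg_powr filterlim_ident) auto
  \<comment> \<open>The factor \<open>1 + k\<close> makes one smallness condition cover the value,
    with constant \<open>B\<close>, and the slope, with constant \<open>B * k\<close>.\<close>
  moreover have "0 < c / (B * (1 + k))" using B c k by simp
  ultimately have "eventually (\<lambda>y. y powr (\<kappa> - k) < c / (B * (1 + k))) at_top"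
    by (rule order_tendstoD(2))
  then have "eventually (\<lambda>y. y powr (\<kappa> - k) < c / (B * (1 + k)) \<and> y \<ge> max N 1) at_top"
    by (intro eventually_conj eventually_ge_at_top)
  then obtain y where y: "y powr (\<kappa> - k) < c / (B * (1 + k))" "y \<ge> N" "y \<ge> 1"
    by (auto simp: eventually_at_top_linorder)
  have "y powr (\<kappa> - k) * (B * (1 + k)) < c"
    using y(1) B k by (simp add: pos_less_divide_eq)
  then have sm: "B * y powr (\<kappa> - k) + B * k * y powr (\<kappa> - k) < c"
    by (simp add: algebra_simps)
  have pp: "0 < B * y powr (\<kappa> - k)" "0 < B * k * y powr (\<kappa> - k)"
    using B k y by auto
  have lower: "c * y powr (- 1 - \<kappa>) \<le> C / (1 + 3 * (2 * y)) powr (1 + \<kappa>)"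
  proof -
    have "c * y powr (- 1 - \<kappa>) = C / (8 * y) powr (1 + \<kappa>)"
    proof -
      have "y powr (- 1 - \<kappa>) = inverse (y powr (1 + \<kappa>))"
        using powr_minus[of y "1 + \<kappa>"] by simp
      then show ?thesis
        using y by (simp add: c_def powr_mult divide_inverse)
    qed
    also have "\<dots> \<le> C / (1 + 3 * (2 * y)) powr (1 + \<kappa>)"
      using C y \<kappa> by (intro divide_left_mono powr_mono2 mult_pos_pos) auto
    finally show ?thesis .
  qed
  show ?thesis
  proof
    show "2 * y \<ge> N" "2 * y \<ge> 1" using y by auto
    show "B > 0" "k > 0" "k * p = k + 2" "B * k * (k + 1) = A * B powr p" by fact+
    have "B * (2 * y / 2) powr - k = B * y powr (\<kappa> - k) * y powr - \<kappa>"
      using y by (simp add: mult.assoc powr_add[symmetric])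
    also have "\<dots> < c * y powr - \<kappa>"
      using sm pp y by (intro mult_strict_right_mono) auto
    also have "\<dots> = c * y powr (- 1 - \<kappa>) * y"
      using y powr_mult_base[of y "- 1 - \<kappa>"] by (simp add: mult.commute[of _ y])
    also have "\<dots> \<le> C / (1 + 3 * (2 * y)) powr (1 + \<kappa>) * (2 * y / 2)"
      using mult_right_mono[OF lower, of y] y by simp
    finally show "B * (2 * y / 2) powr - k < C / (1 + 3 * (2 * y)) powr (1 + \<kappa>) * (2 * y / 2)" .
    have "B * k * (2 * y / 2) powr (- k - 1) = B * k * y powr (\<kappa> - k) * y powr (- 1 - \<kappa>)"
      using y by (simp add: mult.assoc powr_add[symmetric])
    also have "\<dots> \<le> c * y powr (- 1 - \<kappa>)"
      using sm pp y by (intro mult_right_mono) auto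
    also note lower
    finally show "B * k * (2 * y / 2) powr (- k - 1) \<le> C / (1 + 3 * (2 * y)) powr (1 + \<kappa>)" .
  qed
qed

section \<open>Choice of the cone and contradiction on its axis\<close>

theorem theorem2p1:
  fixes F :: "real \<Rightarrow> real" and f g :: "real^'n \<Rightarrow> real"
    and p A \<kappa> R C\<^sub>0 :: real
  assumes dim: "CARD('n) = 2 \<or> CARD('n) = 3"
    and p: "p > 1"
    and F_C1: "F C1_differentiable_on UNIV"
    and A: "A > 0"
    and F_lower: "\<forall>s\<ge>0. F s \<ge> A * s powr p"
    and kappa: "0 < \<kappa>" "\<kappa> < 2 / (p - 1)"
    and f_C3: "Ck_space 3 f"
    and g_C2: "Ck_space 2 g"
    and R: "R > 0"
    and C0: "C\<^sub>0 > 0"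
    and data: "\<forall>x. norm x \<ge> R \<longrightarrow>
        f x > 0 \<and>
        f x / (1 + norm x) - norm (grad f x) + g x \<ge> C\<^sub>0 / (1 + norm x) powr (1 + \<kappa>)"
  shows "\<not> (\<exists>u. global_classical_solution F f g u)"
proof
  assume "\<exists>u. global_classical_solution F f g u"
  then obtain u where u: "Ck_halfspace 2 u"
    and wave: "\<And>x t. t \<ge> 0 \<Longrightarrow>
        pdt_st (pdt_st u) x t - (\<Sum>i\<in>UNIV. pdx_st i (pdx_st i u) x t) = F (u x t)"
    and u0: "\<And>x. u x 0 = f x" and u1: "\<And>x. pdt_st u x 0 = g x"
    unfolding global_classical_solution_def by blast
  \<comment> \<open>Both dimensions are treated at once: in the plane the injection misses one of
    the three coordinates.\<close>
  obtain \<iota> :: "'n \<Rightarrow> nat" where \<iota>: "inj \<iota>" "range \<iota> \<subseteq> {..<3}"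
    using card_le_inj[of "UNIV :: 'n set" "{..<3::nat}"] dim by auto
  obtain T B k where T: "T \<ge> R" "T \<ge> 1" and B: "B > 0" and k: "k > 0" "k * p = k + 2"
    and Bk: "B * k * (k + 1) = A * B powr p"
    and start: "B * (T / 2) powr - k < C\<^sub>0 / (1 + 3 * T) powr (1 + \<kappa>) * (T / 2)"
    and slope: "B * k * (T / 2) powr (- k - 1) \<le> C\<^sub>0 / (1 + 3 * T) powr (1 + \<kappa>)"
    using blowup_profile_dominated[OF A C0 p kappa, of R] by blast
  define M where "M = C\<^sub>0 / (1 + 3 * T) powr (1 + \<kappa>)"
  have M: "M > 0" using C0 T by (simp add: M_def)
  \<comment> \<open>The ball of radius \<open>T\<close> around such a point lies in
    \<open>T \<le> norm y \<le> 3 * T\<close>: the data condition holds there since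
    \<open>T \<ge> R\<close>, and \<open>3 * T\<close> gives the constant \<open>M\<close>.\<close>
  obtain x0 :: "real^'n" where x0: "norm x0 = 2 * T"
    using vector_choose_size[of "2 * T"] T by auto
  have ball: "T \<le> norm y" "norm y \<le> 3 * T" if "dist y x0 \<le> T" for y
    using that x0 norm_triangle_ineq2[of x0 y] norm_triangle_ineq2[of y x0]
    by (auto simp: dist_norm norm_minus_commute)
  have u_pos: "u y 0 > 0" if "dist y x0 \<le> T" for y
    using data ball[OF that] T by (simp add: u0)
  have u_data: "s * M \<le> u y 0 - s * norm (grad (\<lambda>y. u y 0) y) + s * pdt_st u y 0"
    if "dist y x0 \<le> T" "0 \<le> s" "s \<le> T" for y s
  proof -
    note y = ball[OF that(1)]
    have "M \<le> C\<^sub>0 / (1 + norm y) powr (1 + \<kappa>)"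
      unfolding M_def using C0 y T kappa by (intro divide_left_mono powr_mono2 mult_pos_pos) auto
    also have "\<dots> \<le> f y / (1 + norm y) - norm (grad f y) + g y"
      using data y T by auto
    finally have "s * M \<le> s * (f y / (1 + norm y) - norm (grad f y) + g y)"
      using that by (intro mult_left_mono)
    \<comment> \<open>Positivity of \<open>f\<close> together with
      \<open>s \<le> T \<le> norm y\<close> allows replacing \<open>s / (1 + norm y)\<close> by
      1.\<close>
    moreover have "s * (f y / (1 + norm y)) \<le> f y"
    proof -
      have "f y > 0" using u_pos[OF that(1)] by (simp add: u0)
      then have "s * f y \<le> (1 + norm y) * f y"
        using that y by (intro mult_right_mono) auto
      then show ?thesis by (simp add: pos_divide_le_eq add_pos_nonneg mult.commute)
    qed
    ultimately show ?thesis by (simp add: u0 u1 algebra_simps)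
  qed
  define v where "v s = B * (T - s) powr - k" for s
  define v' where "v' s = B * k * (T - s) powr (- k - 1)" for s
  define v'' where "v'' s = B * k * (k + 1) * (T - s) powr (- k - 2)" for s
  have dpowr: "((\<lambda>s. (T - s) powr e) has_real_derivative - e * (T - s) powr (e - 1)) (at s)" if "s < T" for s e
    using that by (auto intro!: derivative_eq_intros)
  have dv: "(v has_real_derivative v' s) (at s)" if "s < T" for s
    using DERIV_cmult[OF dpowr[OF that, of "- k"], of B] by (simp add: v_def[abs_def] v'_def mult.assoc)
  have dv': "(v' has_real_derivative v'' s) (at s)" if "s < T" for s
    using DERIV_cmult[OF dpowr[OF that, of "- k - 1"], of "B * k"]
    by (simp add: v'_def[abs_def] v''_def mult.assoc add.commute)
  have "v'' s = A * v s powr p" if "s < T" for s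
  proof -
    have "v s powr p = B powr p * (T - s) powr (- k * p)"
      using B by (simp add: v_def powr_mult powr_powr)
    moreover have "- k * p = - k - 2" using k by simp
    ultimately show ?thesis unfolding v''_def Bk by (simp add: mult.assoc)
  qed
  then have v'': "0 \<le> v s \<and> v'' s \<le> A * v s powr p" if "s < T" for s
    using that B by (simp add: v_def)
  \<comment> \<open>The comparison is made up to each \<open>b < T\<close> separately, because the
    profile blows up at \<open>T\<close> itself.\<close>
  have above: "v b < u x0 b" if "T / 2 \<le> b" "b < T" for b
  proof (rule blowup_in_cone[OF \<iota> u wave _ A p _ M u_pos u_data, where a = "T / 2" and v' = v' and v'' = v''])
    show "v (T / 2) < M * (T / 2)" "v' (T / 2) \<le> M"
      using start slope by (simp_all add: v_def v'_def M_def)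
  qed (use that T F_lower dv dv' v'' in auto)
  have "continuous_on {0..T} (u x0)"
    by (rule continuous_on_halfspace_compose[OF Ck_halfspace_continuous(1)[OF Ck_halfspace_2D(1)[OF u]]])
       (auto intro!: continuous_intros)
  then have "bdd_above (u x0 ` {0..T})"
    by (intro bounded_imp_bdd_above compact_imp_bounded compact_continuous_image) auto
  then obtain m where m: "\<And>t. 0 \<le> t \<Longrightarrow> t \<le> T \<Longrightarrow> u x0 t \<le> m"
    unfolding bdd_above_def by (metis atLeastAtMost_iff imageI)
  have "filterlim (\<lambda>y. B * y powr - k) at_top (at_right 0)"
    using B k by real_asymp
  then have "eventually (\<lambda>y. m \<le> B * y powr - k) (at_right 0)"
    by (simp add: filterlim_at_top)
  then obtain d where d: "d > 0" "\<And>y. 0 < y \<Longrightarrow> y < d \<Longrightarrow> m \<le> B * y powr - k"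
    by (auto simp: eventually_at_right_field)
  \<comment> \<open>Small enough for the profile to exceed \<open>m\<close> at \<open>T - y\<close>,
    and at most \<open>T / 2\<close> so that the comparison is available at that time.\<close>
  define y where "y = min (d / 2) (T / 2)"
  have y: "0 < y" "y < d" "y \<le> T / 2" using d T by (auto simp: y_def)
  have "m \<le> v (T - y)" using d(2)[OF y(1,2)] by (simp add: v_def)
  moreover have "v (T - y) < u x0 (T - y)" using y by (intro above) auto
  moreover have "u x0 (T - y) \<le> m" using y T by (intro m) auto
  ultimately show False by simp
qed

end
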